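(* Let $\Lambda$ be a $k$-graph. The canonical continuous map $\pi:\mathcal{R}\widetilde{Q}(\Lambda)\to X_\Lambda$, i.e. the unique continuous map satisfying $\pi\circ\widehat{\varphi}=\widetilde{\varphi}$ for every cube $\varphi\in\widetilde{Q}(\Lambda)$, is a homeomorphism.
   Context: Conventions: $0\in\mathbb{N}$ and $\mathbb{N}^0=\{0\}$. A $k$-graph ($k\ge0$) is a nonempty countable small category $\Lambda$ with a functor $d:\Lambda\to\mathbb{N}^k$ (the degree) satisfying the factorisation property: whenever $d(\lambda)=m+n$ there are unique $\mu,\nu\in\Lambda$ with $d(\mu)=m$, $d(\nu)=n$, $\lambda=\mu\nu$. $\Lambda^n=d^{-1}(n)$. For $0\le m\le n\le d(\lambda)$, $\lambda(m,n)$ is the unique $\beta\in\Lambda^{n-m}$ with $\lambda=\alpha\beta\gamma$ for some $\alpha\in\Lambda^m$, $\gamma\in\Lambda^{d(\lambda)-n}$. $e_i$ are the standard generators, $\mathbf{1}_r=\sum_{i=1}^re_i\in\mathbb{N}^r$, $\le$ is coordinatewise. A quasimorphism from a $k$-graph $(\Lambda,d)$ to an $l$-graph $(\Gamma,d')$ is a functor $\psi$ for which there is a homomorphism $\rho:\mathbb{N}^k\to\mathbb{N}^l$ with $\rho\circ d=d'\circ\psi$. Topological realisation $X_\Lambda$: for $n\in\mathbb{N}^k$ let $[0,n]=\{t\in\mathbb{R}^k:0\le t\le n\}$; $\lfloor t\rfloor,\lceil t\rceil$ are coordinatewise. On $\bigsqcup_{\lambda\in\Lambda}\{\lambda\}\times[0,d(\lambda)]$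 define $(\mu,s)\sim(\nu,t)$ iff $s-\lfloor s\rfloor=t-\lfloor t\rfloor$ and $\mu(\lfloor s\rfloor,\lceil s\rceil)=\nu(\lfloor t\rfloor,\lceil t\rceil)$. $X_\Lambda$ is the quotient space; $[\lambda,t]$ is the class of $(\lambda,t)$. The cubical set $\widetilde{Q}(\Lambda)$: $\mathbb{1}_r$ is the $r$-graph $\{(p,q)\in\mathbb{N}^r\times\mathbb{N}^r:p\le q\le\mathbf{1}_r\}$ with $r(p,q)=(p,p)$, $s(p,q)=(q,q)$, $d(p,q)=q-p$, $(p,q)(q,u)=(p,u)$. $\varepsilon_i^\ell:\mathbb{1}_r\to\mathbb{1}_{r+1}$ ($1\le i\le r+1$, $\ell\in\{0,1\}$) inserts $\ell$ as the $i$th coordinate in both entries; $\eta_i:\mathbb{1}_r\to\mathbb{1}_{r-1}$ ($1\le i\le r$) deletes the $i$th coordinate in both entries. A homomorphism $h:\mathbb{N}^r\to\mathbb{N}^k$ is admissible if there are $t\geq 0$, $1\le i_1<\dots<i_t\le r$ and $1\le j_1<\dots<j_t\le k$ with $h(e_{i_p})=e_{j_p}$ for $p\le t$ and $h(e_i)=0$ otherwise. $\widetilde{Q}_r(\Lambda)$ is the set of $r$-cubes: quasimorphisms $\varphi:\mathbb{1}_r\to\Lambda$ with $d_\Lambda\circ\varphi=h\circ d_{\mathbb{1}_r}$ for some (associated) admissible $h:\mathbb{N}^r\to\mathbb{N}^k$. Put $\overline{\varepsilon}^\ell_i(\varphi)=\varphi\circ\varepsilon_i^\ell$ and $\overline{\eta}_i(\varphi)=\varphi\circ\eta_i$,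 and $\widetilde{Q}(\Lambda)=\bigcup_r\widetilde{Q}_r(\Lambda)$. Realisation of the cubical set: $\mathbf{I}^r=[0,1]^r$; $\dot{\varepsilon}_i^\ell:\mathbf{I}^r\to\mathbf{I}^{r+1}$ inserts $\ell$ as $i$th coordinate and $\dot{\eta}_i:\mathbf{I}^r\to\mathbf{I}^{r-1}$ deletes the $i$th coordinate. $\mathcal{R}\widetilde{Q}(\Lambda)$ is the topological space with continuous maps $\widehat{\varphi}:\mathbf{I}^r\to\mathcal{R}\widetilde{Q}(\Lambda)$, for $\varphi\in\widetilde{Q}_r(\Lambda)$, $r\ge0$, satisfying $\widehat{\varphi}\circ\dot{\varepsilon}_i^\ell=\widehat{\overline{\varepsilon}_i^\ell(\varphi)}$ and $\widehat{\varphi}\circ\dot{\eta}_i=\widehat{\overline{\eta}_i(\varphi)}$, that is universal: for any space $X$ and continuous maps $\widetilde{\varphi}:\mathbf{I}^r\to X$ ($\varphi\in\widetilde{Q}_r(\Lambda)$, $r\geq 0$) satisfying the analogous identities $\widetilde{\varphi}\circ\dot{\varepsilon}_i^\ell=(\overline{\varepsilon}_i^\ell(\varphi))^{\sim}$, $\widetilde{\varphi}\circ\dot{\eta}_i=(\overline{\eta}_i(\varphi))^{\sim}$, there is a unique continuous $\pi:\mathcal{R}\widetilde{Q}(\Lambda)\to X$ with $\pi\circ\widehat{\varphi}=\widetilde{\varphi}$ for all $\varphi$. For $\varphi\in\widetilde{Q}_r(\Lambda)$ with associated admissible map $h$, extended to $\mathbb{R}^r\to\mathbb{R}^k$ by $h(t)=\sum_it_ih(e_i)$,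 define $\widetilde{\varphi}:\mathbf{I}^r\to X_\Lambda$ by $\widetilde{\varphi}(t)=[\varphi(0,\mathbf{1}_r),h(t)]$. These maps are continuous and satisfy $\widetilde{\varphi}\circ\dot{\varepsilon}_i^\ell=(\overline{\varepsilon}_i^\ell(\varphi))^{\sim}$ and $\widetilde{\varphi}\circ\dot{\eta}_i=(\overline{\eta}_i(\varphi))^{\sim}$, so they determine the map $\pi:\mathcal{R}\widetilde{Q}(\Lambda)\to X_\Lambda$. *)

theory Defs
  imports "HOL-Analysis.Analysis" "HOL-Library.Function_Algebras"
begin

section \<open>The monoids $\mathbf{N}^k$\<close>

text \<open>
  A vector with \<open>k\<close> coordinates is a function on \<^typ>\<open>nat\<close> vanishing at all
  indices \<open>\<ge> k\<close>, as for \<^const>\<open>Euclidean_space\<close>; coordinates are numbered from \<open>0\<close>.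
  Sums, differences and the order on such vectors are the pointwise ones.
\<close>

definition Nvec :: "nat \<Rightarrow> (nat \<Rightarrow> nat) set" where
  "Nvec k = {n. \<forall>i\<ge>k. n i = 0}"

definition gen :: "nat \<Rightarrow> nat \<Rightarrow> nat" where
  "gen i = (\<lambda>j. if j = i then 1 else 0)"

definition ones :: "nat \<Rightarrow> nat \<Rightarrow> nat" where
  "ones r = (\<lambda>i. if i < r then 1 else 0)"

definition Nvec_hom :: "nat \<Rightarrow> nat \<Rightarrow> ((nat \<Rightarrow> nat) \<Rightarrow> nat \<Rightarrow> nat) \<Rightarrow> bool" where
  "Nvec_hom k l h \<longleftrightarrow>
     h \<in> Nvec k \<rightarrow> Nvec l \<and> h 0 = 0 \<and> (\<forall>m\<in>Nvec k. \<forall>n\<in>Nvec k. h (m + n) = h m + h n)"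

definition admissible :: "nat \<Rightarrow> nat \<Rightarrow> ((nat \<Rightarrow> nat) \<Rightarrow> nat \<Rightarrow> nat) \<Rightarrow> bool" where
  "admissible r k h \<longleftrightarrow> Nvec_hom r k h \<and>
     (\<exists>(t::nat) (i::nat \<Rightarrow> nat) (j::nat \<Rightarrow> nat).
        i \<in> {..<t} \<rightarrow> {..<r} \<and> strict_mono_on {..<t} i \<and>
        j \<in> {..<t} \<rightarrow> {..<k} \<and> strict_mono_on {..<t} j \<and>
        (\<forall>p<t. h (gen (i p)) = gen (j p)) \<and>
        (\<forall>q\<in>{..<r} - i ` {..<t}. h (gen q) = 0))"


section \<open>Higher-rank graphs\<close>

text \<open>
  Small categories are given by their morphisms only: an object is identified with its
  identity morphism, so range and source take values in the set of morphisms. The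
  composite \<open>comp \<mu> \<nu>\<close> is meaningful when the source of \<open>\<mu>\<close> is the range of \<open>\<nu>\<close>.
\<close>

record 'a graded_cat =
  arr :: "'a set"
  rng :: "'a \<Rightarrow> 'a"
  src :: "'a \<Rightarrow> 'a"
  comp :: "'a \<Rightarrow> 'a \<Rightarrow> 'a"
  deg :: "'a \<Rightarrow> nat \<Rightarrow> nat"

definition small_category :: "'a graded_cat \<Rightarrow> bool" where
  "small_category \<Lambda> \<longleftrightarrow>
     (\<forall>x\<in>arr \<Lambda>. rng \<Lambda> x \<in> arr \<Lambda> \<and> src \<Lambda> x \<in> arr \<Lambda> \<and>
        rng \<Lambda> (rng \<Lambda> x) = rng \<Lambda> x \<and> src \<Lambda> (rng \<Lambda> x) = rng \<Lambda> x \<and>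
        rng \<Lambda> (src \<Lambda> x) = src \<Lambda> x \<and> src \<Lambda> (src \<Lambda> x) = src \<Lambda> x \<and>
        comp \<Lambda> (rng \<Lambda> x) x = x \<and> comp \<Lambda> x (src \<Lambda> x) = x) \<and>
     (\<forall>x\<in>arr \<Lambda>. \<forall>y\<in>arr \<Lambda>. src \<Lambda> x = rng \<Lambda> y \<longrightarrow>
        comp \<Lambda> x y \<in> arr \<Lambda> \<and> rng \<Lambda> (comp \<Lambda> x y) = rng \<Lambda> x \<and> src \<Lambda> (comp \<Lambda> x y) = src \<Lambda> y) \<and>
     (\<forall>x\<in>arr \<Lambda>. \<forall>y\<in>arr \<Lambda>. \<forall>z\<in>arr \<Lambda>. src \<Lambda> x = rng \<Lambda> y \<and> src \<Lambda> y = rng \<Lambda> z \<longrightarrow>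
        comp \<Lambda> (comp \<Lambda> x y) z = comp \<Lambda> x (comp \<Lambda> y z))"

definition k_graph :: "nat \<Rightarrow> 'a graded_cat \<Rightarrow> bool" where
  "k_graph k \<Lambda> \<longleftrightarrow>
     small_category \<Lambda> \<and> arr \<Lambda> \<noteq> {} \<and> countable (arr \<Lambda>) \<and>
     deg \<Lambda> \<in> arr \<Lambda> \<rightarrow> Nvec k \<and>
     (\<forall>x\<in>arr \<Lambda>. deg \<Lambda> (rng \<Lambda> x) = 0 \<and> deg \<Lambda> (src \<Lambda> x) = 0) \<and>
     (\<forall>x\<in>arr \<Lambda>. \<forall>y\<in>arr \<Lambda>. src \<Lambda> x = rng \<Lambda> y \<longrightarrow> deg \<Lambda> (comp \<Lambda> x y) = deg \<Lambda> x + deg \<Lambda> y) \<and>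
     (\<forall>x\<in>arr \<Lambda>. \<forall>m\<in>Nvec k. \<forall>n\<in>Nvec k. deg \<Lambda> x = m + n \<longrightarrow>
        (\<exists>!(\<mu>, \<nu>). \<mu> \<in> arr \<Lambda> \<and> \<nu> \<in> arr \<Lambda> \<and> src \<Lambda> \<mu> = rng \<Lambda> \<nu> \<and>
           deg \<Lambda> \<mu> = m \<and> deg \<Lambda> \<nu> = n \<and> x = comp \<Lambda> \<mu> \<nu>))"

text \<open>\<open>segment \<Lambda> \<lambda> m n\<close> is the factor usually written $\lambda(m,n)$.\<close>

definition segment :: "'a graded_cat \<Rightarrow> 'a \<Rightarrow> (nat \<Rightarrow> nat) \<Rightarrow> (nat \<Rightarrow> nat) \<Rightarrow> 'a" where
  "segment \<Lambda> x m n = (THE \<beta>. \<beta> \<in> arr \<Lambda> \<and> deg \<Lambda> \<beta> = n - m \<and>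
     (\<exists>\<alpha>\<in>arr \<Lambda>. \<exists>\<gamma>\<in>arr \<Lambda>. deg \<Lambda> \<alpha> = m \<and> deg \<Lambda> \<gamma> = deg \<Lambda> x - n \<and>
        src \<Lambda> \<alpha> = rng \<Lambda> \<beta> \<and> src \<Lambda> \<beta> = rng \<Lambda> \<gamma> \<and> x = comp \<Lambda> \<alpha> (comp \<Lambda> \<beta> \<gamma>)))"

definition cat_functor :: "'a graded_cat \<Rightarrow> 'b graded_cat \<Rightarrow> ('a \<Rightarrow> 'b) \<Rightarrow> bool" where
  "cat_functor \<Lambda> \<Gamma> \<psi> \<longleftrightarrow> \<psi> \<in> arr \<Lambda> \<rightarrow> arr \<Gamma> \<and>
     (\<forall>x\<in>arr \<Lambda>. \<psi> (rng \<Lambda> x) = rng \<Gamma> (\<psi> x) \<and> \<psi> (src \<Lambda> x) = src \<Gamma> (\<psi> x)) \<and>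
     (\<forall>x\<in>arr \<Lambda>. \<forall>y\<in>arr \<Lambda>. src \<Lambda> x = rng \<Lambda> y \<longrightarrow> \<psi> (comp \<Lambda> x y) = comp \<Gamma> (\<psi> x) (\<psi> y))"

definition quasimorphism ::
    "nat \<Rightarrow> nat \<Rightarrow> 'a graded_cat \<Rightarrow> 'b graded_cat \<Rightarrow> ('a \<Rightarrow> 'b) \<Rightarrow> bool" where
  "quasimorphism k l \<Lambda> \<Gamma> \<psi> \<longleftrightarrow> cat_functor \<Lambda> \<Gamma> \<psi> \<and>
     (\<exists>\<rho>. Nvec_hom k l \<rho> \<and> (\<forall>x\<in>arr \<Lambda>. \<rho> (deg \<Lambda> x) = deg \<Gamma> (\<psi> x)))"


section \<open>Quotient spaces\<close>

definition quotient_space :: "'a topology \<Rightarrow> ('a \<times> 'a) set \<Rightarrow> 'a set topology" where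
  "quotient_space X E = topology (\<lambda>U. U \<subseteq> topspace X // E \<and> openin X {x \<in> topspace X. E `` {x} \<in> U})"

lemma openin_quotient_space:
  "openin (quotient_space X E) U \<longleftrightarrow>
     U \<subseteq> topspace X // E \<and> openin X {x \<in> topspace X. E `` {x} \<in> U}"
proof -
  have 1: "{x \<in> topspace X. E `` {x} \<in> S \<inter> T} =
      {x \<in> topspace X. E `` {x} \<in> S} \<inter> {x \<in> topspace X. E `` {x} \<in> T}" for S T
    by auto
  have 2: "{x \<in> topspace X. E `` {x} \<in> \<Union>\<K>} = (\<Union>K\<in>\<K>. {x \<in> topspace X. E `` {x} \<in> K})" for \<K>
    by auto
  have "istopology (\<lambda>U. U \<subseteq> topspace X // E \<and> openin X {x \<in> topspace X. E `` {x} \<in> U})"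
    unfolding istopology_def 1 2 by blast
  then show ?thesis
    unfolding quotient_space_def by (simp add: topology_inverse')
qed

lemma topspace_quotient_space [simp]: "topspace (quotient_space X E) = topspace X // E"
proof -
  have "{x \<in> topspace X. E `` {x} \<in> topspace X // E} = topspace X"
    by (auto simp: quotient_def)
  then have "openin (quotient_space X E) (topspace X // E)"
    by (simp add: openin_quotient_space)
  then show ?thesis
    by (meson openin_quotient_space openin_subset openin_topspace subset_antisym)
qed

lemma quotient_map_quotient_space: "quotient_map X (quotient_space X E) (\<lambda>x. E `` {x})"
  unfolding quotient_map_def by (auto simp: openin_quotient_space quotient_def)


section \<open>The topological realisation of a $k$-graph\<close>

definition box :: "nat \<Rightarrow> (nat \<Rightarrow> nat) \<Rightarrow> (nat \<Rightarrow> real) topology" where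
  "box k n = subtopology (Euclidean_space k) {t. \<forall>i. 0 \<le> t i \<and> t i \<le> real (n i)}"

definition box_sum :: "nat \<Rightarrow> 'a graded_cat \<Rightarrow> ('a \<times> (nat \<Rightarrow> real)) topology" where
  "box_sum k \<Lambda> = sum_topology (\<lambda>x. box k (deg \<Lambda> x)) (arr \<Lambda>)"

definition vfloor :: "(nat \<Rightarrow> real) \<Rightarrow> nat \<Rightarrow> nat" where
  "vfloor t = (\<lambda>i. nat \<lfloor>t i\<rfloor>)"

definition vceiling :: "(nat \<Rightarrow> real) \<Rightarrow> nat \<Rightarrow> nat" where
  "vceiling t = (\<lambda>i. nat \<lceil>t i\<rceil>)"

definition realisation_rel ::
    "nat \<Rightarrow> 'a graded_cat \<Rightarrow> (('a \<times> (nat \<Rightarrow> real)) \<times> ('a \<times> (nat \<Rightarrow> real))) set" where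
  "realisation_rel k \<Lambda> = {((\<mu>, s), (\<nu>, t)).
     (\<mu>, s) \<in> topspace (box_sum k \<Lambda>) \<and> (\<nu>, t) \<in> topspace (box_sum k \<Lambda>) \<and>
     (\<forall>i. s i - real (vfloor s i) = t i - real (vfloor t i)) \<and>
     segment \<Lambda> \<mu> (vfloor s) (vceiling s) = segment \<Lambda> \<nu> (vfloor t) (vceiling t)}"

definition realisation :: "nat \<Rightarrow> 'a graded_cat \<Rightarrow> ('a \<times> (nat \<Rightarrow> real)) set topology" where
  "realisation k \<Lambda> = quotient_space (box_sum k \<Lambda>) (realisation_rel k \<Lambda>)"

definition realisation_pt ::
    "nat \<Rightarrow> 'a graded_cat \<Rightarrow> 'a \<Rightarrow> (nat \<Rightarrow> real) \<Rightarrow> ('a \<times> (nat \<Rightarrow> real)) set" where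
  "realisation_pt k \<Lambda> x t = realisation_rel k \<Lambda> `` {(x, t)}"


section \<open>The cubical set of a $k$-graph\<close>

text \<open>In the next two definitions \<open>i\<close> is a coordinate counted from \<open>0\<close>.\<close>

definition insert_coord :: "nat \<Rightarrow> 'c \<Rightarrow> (nat \<Rightarrow> 'c) \<Rightarrow> nat \<Rightarrow> 'c" where
  "insert_coord i c t = (\<lambda>j. if j < i then t j else if j = i then c else t (j - 1))"

definition delete_coord :: "nat \<Rightarrow> (nat \<Rightarrow> 'c) \<Rightarrow> nat \<Rightarrow> 'c" where
  "delete_coord i t = (\<lambda>j. if j < i then t j else t (Suc j))"

type_synonym cube_arr = "(nat \<Rightarrow> nat) \<times> (nat \<Rightarrow> nat)"

definition cube_graph :: "nat \<Rightarrow> cube_arr graded_cat" where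
  "cube_graph r = \<lparr>
     arr = {(p, q). p \<in> Nvec r \<and> q \<in> Nvec r \<and> p \<le> q \<and> q \<le> ones r},
     rng = (\<lambda>(p, q). (p, p)),
     src = (\<lambda>(p, q). (q, q)),
     comp = (\<lambda>(p, q) (q', u). (p, u)),
     deg = (\<lambda>(p, q). q - p)\<rparr>"

text \<open>\<open>admissible_for k \<Lambda> r \<phi> h\<close>: the admissible map \<open>h\<close> is associated to \<open>\<phi>\<close>.\<close>

definition admissible_for ::
    "nat \<Rightarrow> 'a graded_cat \<Rightarrow> nat \<Rightarrow> (cube_arr \<Rightarrow> 'a) \<Rightarrow> ((nat \<Rightarrow> nat) \<Rightarrow> nat \<Rightarrow> nat) \<Rightarrow> bool" where
  "admissible_for k \<Lambda> r \<phi> h \<longleftrightarrow> admissible r k h \<and>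
     (\<forall>x\<in>arr (cube_graph r). deg \<Lambda> (\<phi> x) = h (deg (cube_graph r) x))"

text \<open>Cubes are extensional, so that equality of cubes is equality of functors.\<close>

definition cubes :: "nat \<Rightarrow> 'a graded_cat \<Rightarrow> nat \<Rightarrow> (cube_arr \<Rightarrow> 'a) set" where
  "cubes k \<Lambda> r = {\<phi> \<in> extensional (arr (cube_graph r)).
     quasimorphism r k (cube_graph r) \<Lambda> \<phi> \<and> (\<exists>h. admissible_for k \<Lambda> r \<phi> h)}"

text \<open>
  The face \<open>face r i l\<close> sends \<open>(r + 1)\<close>-cubes to \<open>r\<close>-cubes, the degeneracy
  \<open>degeneracy r i\<close> sends \<open>r\<close>-cubes to \<open>(r + 1)\<close>-cubes; \<open>i \<le> r\<close> in both cases.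
\<close>

definition face :: "nat \<Rightarrow> nat \<Rightarrow> nat \<Rightarrow> (cube_arr \<Rightarrow> 'a) \<Rightarrow> cube_arr \<Rightarrow> 'a" where
  "face r i l \<phi> =
     restrict (\<lambda>(p, q). \<phi> (insert_coord i l p, insert_coord i l q)) (arr (cube_graph r))"

definition degeneracy :: "nat \<Rightarrow> nat \<Rightarrow> (cube_arr \<Rightarrow> 'a) \<Rightarrow> cube_arr \<Rightarrow> 'a" where
  "degeneracy r i \<phi> =
     restrict (\<lambda>(p, q). \<phi> (delete_coord i p, delete_coord i q)) (arr (cube_graph (Suc r)))"


section \<open>The topological realisation of the cubical set\<close>

text \<open>
  Families of maps on cubes carry the dimension as an explicit argument, because the sets
  \<^term>\<open>cubes k \<Lambda> r\<close> for different \<open>r\<close> need not be disjoint as sets of HOL functions.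
\<close>

abbreviation unit_box :: "nat \<Rightarrow> (nat \<Rightarrow> real) topology" where
  "unit_box r \<equiv> box r (ones r)"

definition compatible_maps ::
    "nat \<Rightarrow> 'a graded_cat \<Rightarrow> 'x topology \<Rightarrow>
     (nat \<Rightarrow> (cube_arr \<Rightarrow> 'a) \<Rightarrow> (nat \<Rightarrow> real) \<Rightarrow> 'x) \<Rightarrow> bool" where
  "compatible_maps k \<Lambda> X f \<longleftrightarrow>
     (\<forall>r. \<forall>\<phi>\<in>cubes k \<Lambda> r. continuous_map (unit_box r) X (f r \<phi>)) \<and>
     (\<forall>r. \<forall>\<phi>\<in>cubes k \<Lambda> (Suc r). \<forall>i\<le>r. \<forall>l\<in>{0, 1}. \<forall>t\<in>topspace (unit_box r).
        f (Suc r) \<phi> (insert_coord i (real l) t) = f r (face r i l \<phi>) t) \<and>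
     (\<forall>r. \<forall>\<phi>\<in>cubes k \<Lambda> r. \<forall>i\<le>r. \<forall>t\<in>topspace (unit_box (Suc r)).
        f r \<phi> (delete_coord i t) = f (Suc r) (degeneracy r i \<phi>) t)"

text \<open>
  Maps between spaces are taken extensional, so that uniqueness is uniqueness on the space.
\<close>

definition induced_map ::
    "nat \<Rightarrow> 'a graded_cat \<Rightarrow>
     'r topology \<Rightarrow> (nat \<Rightarrow> (cube_arr \<Rightarrow> 'a) \<Rightarrow> (nat \<Rightarrow> real) \<Rightarrow> 'r) \<Rightarrow>
     'x topology \<Rightarrow> (nat \<Rightarrow> (cube_arr \<Rightarrow> 'a) \<Rightarrow> (nat \<Rightarrow> real) \<Rightarrow> 'x) \<Rightarrow> ('r \<Rightarrow> 'x) \<Rightarrow> bool" where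
  "induced_map k \<Lambda> R hat X f \<pi> \<longleftrightarrow>
     \<pi> \<in> extensional (topspace R) \<and> continuous_map R X \<pi> \<and>
     (\<forall>r. \<forall>\<phi>\<in>cubes k \<Lambda> r. \<forall>t\<in>topspace (unit_box r). \<pi> (hat r \<phi> t) = f r \<phi> t)"

text \<open>
  The universal property quantifies over all spaces. A HOL predicate can only quantify over
  the spaces whose points lie in one type, which is the first argument below.
\<close>

definition cubical_realisation ::
    "'x itself \<Rightarrow> nat \<Rightarrow> 'a graded_cat \<Rightarrow>
     'r topology \<Rightarrow> (nat \<Rightarrow> (cube_arr \<Rightarrow> 'a) \<Rightarrow> (nat \<Rightarrow> real) \<Rightarrow> 'r) \<Rightarrow> bool" where
  "cubical_realisation T k \<Lambda> R hat \<longleftrightarrow> compatible_maps k \<Lambda> R hat \<and>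
     (\<forall>(X :: 'x topology) f. compatible_maps k \<Lambda> X f \<longrightarrow> (\<exists>!\<pi>. induced_map k \<Lambda> R hat X f \<pi>))"

text \<open>
  A space with the universal property for every type of points at once: the quotient of the
  disjoint union of all cubes by the identifications that compatibility demands.
\<close>

definition cube_sum ::
    "nat \<Rightarrow> 'a graded_cat \<Rightarrow> ((nat \<times> (cube_arr \<Rightarrow> 'a)) \<times> (nat \<Rightarrow> real)) topology" where
  "cube_sum k \<Lambda> = sum_topology (\<lambda>(r, \<phi>). unit_box r) (SIGMA r:UNIV. cubes k \<Lambda> r)"

definition cube_glue ::
    "nat \<Rightarrow> 'a graded_cat \<Rightarrow> ((nat \<times> (cube_arr \<Rightarrow> 'a)) \<times> (nat \<Rightarrow> real)) rel" where
  "cube_glue k \<Lambda> =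
     {((((Suc r), \<phi>), insert_coord i (real l) t), ((r, face r i l \<phi>), t)) | r \<phi> i l t.
        \<phi> \<in> cubes k \<Lambda> (Suc r) \<and> i \<le> r \<and> l \<in> {0, 1} \<and> t \<in> topspace (unit_box r)} \<union>
     {(((r, \<phi>), delete_coord i t), ((Suc r, degeneracy r i \<phi>), t)) | r \<phi> i t.
        \<phi> \<in> cubes k \<Lambda> r \<and> i \<le> r \<and> t \<in> topspace (unit_box (Suc r))}"

definition cube_equiv ::
    "nat \<Rightarrow> 'a graded_cat \<Rightarrow> ((nat \<times> (cube_arr \<Rightarrow> 'a)) \<times> (nat \<Rightarrow> real)) rel" where
  "cube_equiv k \<Lambda> = (cube_glue k \<Lambda> \<union> (cube_glue k \<Lambda>)\<inverse>)\<^sup>*"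

lemma cube_equiv_class_eq:
  assumes "(x, y) \<in> cube_glue k \<Lambda>"
  shows "cube_equiv k \<Lambda> `` {x} = cube_equiv k \<Lambda> `` {y}"
proof -
  have "(x, y) \<in> cube_equiv k \<Lambda>" "(y, x) \<in> cube_equiv k \<Lambda>"
    using assms unfolding cube_equiv_def by blast+
  moreover have "trans (cube_equiv k \<Lambda>)"
    unfolding cube_equiv_def by (rule trans_rtrancl)
  ultimately show ?thesis
    unfolding trans_def by blast
qed

lemma cube_equiv_imp_eq:
  assumes f: "compatible_maps k \<Lambda> X f" and xy: "(x, y) \<in> cube_equiv k \<Lambda>"
  shows "f (fst (fst x)) (snd (fst x)) (snd x) = f (fst (fst y)) (snd (fst y)) (snd y)"
proof -
  have G: "f (fst (fst x)) (snd (fst x)) (snd x) = f (fst (fst y)) (snd (fst y)) (snd y)"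
    if "(x, y) \<in> cube_glue k \<Lambda>" for x y
    using that f unfolding cube_glue_def compatible_maps_def by auto
  show ?thesis
    using xy unfolding cube_equiv_def
  proof (induction rule: rtrancl_induct)
    case base
    show ?case by simp
  next
    case (step y z)
    then show ?case
      by (metis G Un_iff converseD)
  qed
qed

theorem cubical_realisation_exists:
  fixes \<Lambda> :: "'a graded_cat"
  shows "cubical_realisation TYPE('x) k \<Lambda>
           (quotient_space (cube_sum k \<Lambda>) (cube_equiv k \<Lambda>))
           (\<lambda>r \<phi> t. cube_equiv k \<Lambda> `` {((r, \<phi>), t)})"
    (is "cubical_realisation _ _ _ ?R ?hat")
proof -
  let ?q = "\<lambda>x. cube_equiv k \<Lambda> `` {x}"
  have q: "quotient_map (cube_sum k \<Lambda>) ?R ?q"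
    by (rule quotient_map_quotient_space)
  have top: "topspace (cube_sum k \<Lambda>) =
      {((r, \<phi>), t) | r \<phi> t. \<phi> \<in> cubes k \<Lambda> r \<and> t \<in> topspace (unit_box r)}"
    unfolding cube_sum_def by auto
  have inj: "continuous_map (unit_box r) (cube_sum k \<Lambda>) (\<lambda>t. ((r, \<phi>), t))"
    if "\<phi> \<in> cubes k \<Lambda> r" for r \<phi>
  proof -
    have "(r, \<phi>) \<in> (SIGMA r:UNIV. cubes k \<Lambda> r)"
      using that by simp
    from continuous_map_component_injection[OF this, of "\<lambda>(r, \<phi>). unit_box r"]
    show ?thesis
      unfolding cube_sum_def by simp
  qed
  have c1: "continuous_map (unit_box r) ?R (?hat r \<phi>)" if "\<phi> \<in> cubes k \<Lambda> r" for r \<phi>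
    using continuous_map_compose[OF inj[OF that] quotient_imp_continuous_map[OF q]]
    by (simp add: o_def)
  have c2: "?hat (Suc r) \<phi> (insert_coord i (real l) t) = ?hat r (face r i l \<phi>) t"
    if "\<phi> \<in> cubes k \<Lambda> (Suc r)" "i \<le> r" "l \<in> {0, 1}" "t \<in> topspace (unit_box r)" for r \<phi> i l t
    by (rule cube_equiv_class_eq) (use that in \<open>unfold cube_glue_def, blast\<close>)
  have c3: "?hat r \<phi> (delete_coord i t) = ?hat (Suc r) (degeneracy r i \<phi>) t"
    if "\<phi> \<in> cubes k \<Lambda> r" "i \<le> r" "t \<in> topspace (unit_box (Suc r))" for r \<phi> i t
    by (rule cube_equiv_class_eq) (use that in \<open>unfold cube_glue_def, blast\<close>)
  have "compatible_maps k \<Lambda> ?R ?hat"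
    unfolding compatible_maps_def by (intro conjI allI ballI impI c1 c2 c3)
  moreover have "\<exists>!\<pi>. induced_map k \<Lambda> ?R ?hat X f \<pi>"
    if f: "compatible_maps k \<Lambda> X f" for X :: "'x topology" and f
  proof -
    define F where "F x = f (fst (fst x)) (snd (fst x)) (snd x)" for x
    have "continuous_map (cube_sum k \<Lambda>) X F"
    proof -
      have *: "continuous_map (unit_box r) X (\<lambda>t. F ((r, \<phi>), t))" if "\<phi> \<in> cubes k \<Lambda> r" for r \<phi>
        using f that unfolding compatible_maps_def F_def by simp
      show ?thesis
        unfolding continuous_map_def
      proof (intro conjI allI impI)
        show "F \<in> topspace (cube_sum k \<Lambda>) \<rightarrow> topspace X"
          using * unfolding top continuous_map_def by blast
      next
        fix U
        assume U: "openin X U"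
        have "openin (unit_box r) {t. ((r, \<phi>), t) \<in> {x \<in> topspace (cube_sum k \<Lambda>). F x \<in> U}}"
          if "\<phi> \<in> cubes k \<Lambda> r" for r \<phi>
        proof -
          have "{t. ((r, \<phi>), t) \<in> {x \<in> topspace (cube_sum k \<Lambda>). F x \<in> U}} =
              {t \<in> topspace (unit_box r). F ((r, \<phi>), t) \<in> U}"
            using that by (simp add: top)
          then show ?thesis
            using openin_continuous_map_preimage[OF *[OF that] U] by simp
        qed
        moreover have "{x \<in> topspace (cube_sum k \<Lambda>). F x \<in> U} \<subseteq>
            Sigma (SIGMA r:UNIV. cubes k \<Lambda> r) (topspace \<circ> (\<lambda>(r, \<phi>). unit_box r))"
          unfolding cube_sum_def by auto
        ultimately show "openin (cube_sum k \<Lambda>) {x \<in> topspace (cube_sum k \<Lambda>). F x \<in> U}"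
          by (subst cube_sum_def) (auto simp only: openin_sum_topology split: prod.splits)
      qed
    qed
    moreover have "F x = F y" if "?q x = ?q y" for x y
    proof -
      have "(x, y) \<in> cube_equiv k \<Lambda>"
        using that unfolding cube_equiv_def by blast
      then show ?thesis
        using cube_equiv_imp_eq[OF f] unfolding F_def by blast
    qed
    ultimately obtain g where g: "continuous_map ?R X g"
        "\<And>x. x \<in> topspace (cube_sum k \<Lambda>) \<Longrightarrow> g (?q x) = F x"
      using quotient_map_lift_exists[OF q] by metis
    have top_R: "topspace ?R = ?q ` topspace (cube_sum k \<Lambda>)"
      using quotient_imp_surjective_map[OF q] by simp
    show ?thesis
    proof (rule ex1I[of _ "restrict g (topspace ?R)"])
      show "induced_map k \<Lambda> ?R ?hat X f (restrict g (topspace ?R))"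
        unfolding induced_map_def
      proof (intro conjI allI ballI)
        show "continuous_map ?R X (restrict g (topspace ?R))"
          using g(1) by (rule continuous_map_eq) simp
      next
        fix r \<phi> t
        assume "\<phi> \<in> cubes k \<Lambda> r" "t \<in> topspace (unit_box r)"
        then have x: "((r, \<phi>), t) \<in> topspace (cube_sum k \<Lambda>)"
          by (simp add: top)
        then have "?hat r \<phi> t \<in> topspace ?R"
          unfolding top_R by (rule imageI)
        then show "restrict g (topspace ?R) (?hat r \<phi> t) = f r \<phi> t"
          using g(2)[OF x] by (simp only: restrict_apply if_True F_def fst_conv snd_conv)
      qed simp
    next
      fix \<pi>
      assume \<pi>: "induced_map k \<Lambda> ?R ?hat X f \<pi>"
      show "\<pi> = restrict g (topspace ?R)"
      proof (rule extensionalityI[of _ "topspace ?R"])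
        show "\<pi> \<in> extensional (topspace ?R)"
          using \<pi> by (simp add: induced_map_def)
        fix z
        assume z: "z \<in> topspace ?R"
        then obtain x where x: "x \<in> topspace (cube_sum k \<Lambda>)" "z = ?q x"
          unfolding top_R by blast
        then obtain r \<phi> t where rt: "x = ((r, \<phi>), t)" "\<phi> \<in> cubes k \<Lambda> r" "t \<in> topspace (unit_box r)"
          unfolding top by blast
        have "\<pi> z = f r \<phi> t"
          using \<pi> rt x(2) unfolding induced_map_def by blast
        also have "\<dots> = g z"
          using g(2)[OF x(1)] x(2) rt(1) by (simp add: F_def)
        finally show "\<pi> z = restrict g (topspace ?R) z"
          using z by (simp only: restrict_apply if_True)
      qed simp
    qed
  qed
  ultimately show ?thesis
    unfolding cubical_realisation_def by blast
qed


section \<open>The maps from cubes to the realisation of the $k$-graph\<close>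

text \<open>
  The admissible map associated to a cube \<open>\<phi>\<close> is determined on \<^term>\<open>Nvec r\<close>, so the
  choice in \<open>cube_map\<close> is immaterial.
\<close>

definition hom_extend ::
    "nat \<Rightarrow> ((nat \<Rightarrow> nat) \<Rightarrow> nat \<Rightarrow> nat) \<Rightarrow> (nat \<Rightarrow> real) \<Rightarrow> nat \<Rightarrow> real" where
  "hom_extend r h t = (\<lambda>j. \<Sum>i<r. t i * real (h (gen i) j))"

definition cube_map ::
    "nat \<Rightarrow> 'a graded_cat \<Rightarrow> nat \<Rightarrow> (cube_arr \<Rightarrow> 'a) \<Rightarrow> (nat \<Rightarrow> real) \<Rightarrow>
     ('a \<times> (nat \<Rightarrow> real)) set" where
  "cube_map k \<Lambda> r \<phi> t =
     realisation_pt k \<Lambda> (\<phi> (0, ones r)) (hom_extend r (SOME h. admissible_for k \<Lambda> r \<phi> h) t)"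

end

theory Submission
  imports Defs
begin

text \<open>
  The universal property determines the cubical realisation up to a unique homeomorphism, so it
  suffices to show that the topological realisation $X_\Lambda$ of the $k$-graph, with the maps
  \<^const>\<open>cube_map\<close>, has the same universal property
  (\<open>realisation_is_cubical_realisation\<close>). The canonical map is then a homeomorphism because both
  composites with the map in the other direction solve the same mapping problem as an identity
  (\<open>cubical_realisation_unique\<close>).

  Let \<open>f\<close> be a compatible family of maps from the cubes into a space \<open>X\<close>. A factorisation of \<open>f\<close>
  through $X_\Lambda$ exists on points when \<open>f r \<phi> t\<close> depends only on the point
  \<open>cube_map k \<Lambda> r \<phi> t\<close>. This rests on a normal form. If some coordinate of \<open>t\<close> is \<open>0\<close> or \<open>1\<close>, then
  \<open>(\<phi>, t)\<close> may be replaced by a face of \<open>\<phi>\<close>; if the admissible map of \<open>\<phi>\<close> kills a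
  generator, then \<open>\<phi>\<close> is degenerate and again one coordinate can be dropped. Neither step changes
  the value of any compatible family, and \<open>cube_map\<close> is itself one
  (\<open>compatible_cube_map\<close>). What remains is a cube whose admissible map is an order-preserving
  injection of the generators, at an interior point (\<open>normal_form\<close>). Its image in \<open>k\<close>-space has floor
  \<open>0\<close> and ceiling the degree of $\lambda = \phi(0, \mathbf{1}_r)$, so the point of
  $X_\Lambda$ recovers $\lambda$ and the coordinates, hence the cube (\<open>generic_unique\<close>).

  For surjectivity and continuity, each box $[0, d(\lambda)]$ is cut into the finitely many unit
  cells with integral corners. A cell is a box $[n, m]$ with $m - n \le \mathbf{1}_k$,
  and the cube $(p, q) \mapsto \beta(h(p), h(q))$ built from $\beta = \lambda(n, m)$
  parametrises it (\<open>unit_cell_parametrised\<close>). So the factorisation is continuous on every closed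
  cell, and the pasting lemma applies.
\<close>

section \<open>Factorisations in a higher-rank graph\<close>

lemma Nvec_le: "m \<in> Nvec k" if "m \<le> n" "n \<in> Nvec k"
  using that by (auto simp: Nvec_def le_fun_def) (metis le_0_eq)

lemma Nvec_diff: "n - m \<in> Nvec k" if "n \<in> Nvec k"
  using that by (simp add: Nvec_def)

lemma vec_add_diff: "m + (n - m) = n" if "m \<le> n" for m n :: "nat \<Rightarrow> nat"
  using that by (simp add: fun_eq_iff le_fun_def)

lemma topspace_box: "topspace (box k n) = {t. (\<forall>i\<ge>k. t i = 0) \<and> (\<forall>i. 0 \<le> t i \<and> t i \<le> real (n i))}"
  by (auto simp: box_def topspace_Euclidean_space)

locale higher_rank_graph =
  fixes k :: nat and \<Lambda> :: "'a graded_cat"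
  assumes k_graph: "k_graph k \<Lambda>"
begin

lemma
  assumes x: "x \<in> arr \<Lambda>"
  shows arr_rng: "rng \<Lambda> x \<in> arr \<Lambda>" and arr_src: "src \<Lambda> x \<in> arr \<Lambda>"
    and src_rng: "src \<Lambda> (rng \<Lambda> x) = rng \<Lambda> x" and rng_src: "rng \<Lambda> (src \<Lambda> x) = src \<Lambda> x"
    and comp_rng: "comp \<Lambda> (rng \<Lambda> x) x = x" and comp_src: "comp \<Lambda> x (src \<Lambda> x) = x"
    and deg_rng: "deg \<Lambda> (rng \<Lambda> x) = 0" and deg_src: "deg \<Lambda> (src \<Lambda> x) = 0"
    and deg_Nvec: "deg \<Lambda> x \<in> Nvec k"
proof -
  have "small_category \<Lambda>" and d: "deg \<Lambda> \<in> arr \<Lambda> \<rightarrow> Nvec k"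
    "\<forall>x\<in>arr \<Lambda>. deg \<Lambda> (rng \<Lambda> x) = 0 \<and> deg \<Lambda> (src \<Lambda> x) = 0"
    using k_graph unfolding k_graph_def by - (elim conjE, assumption)+
  then have "rng \<Lambda> x \<in> arr \<Lambda> \<and> src \<Lambda> x \<in> arr \<Lambda> \<and>
        rng \<Lambda> (rng \<Lambda> x) = rng \<Lambda> x \<and> src \<Lambda> (rng \<Lambda> x) = rng \<Lambda> x \<and>
        rng \<Lambda> (src \<Lambda> x) = src \<Lambda> x \<and> src \<Lambda> (src \<Lambda> x) = src \<Lambda> x \<and>
        comp \<Lambda> (rng \<Lambda> x) x = x \<and> comp \<Lambda> x (src \<Lambda> x) = x"
    using x unfolding small_category_def by simp
  then show "rng \<Lambda> x \<in> arr \<Lambda>" "src \<Lambda> x \<in> arr \<Lambda>" "src \<Lambda> (rng \<Lambda> x) = rng \<Lambda> x"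
    "rng \<Lambda> (src \<Lambda> x) = src \<Lambda> x" "comp \<Lambda> (rng \<Lambda> x) x = x" "comp \<Lambda> x (src \<Lambda> x) = x"
    by simp_all
  show "deg \<Lambda> (rng \<Lambda> x) = 0" "deg \<Lambda> (src \<Lambda> x) = 0" "deg \<Lambda> x \<in> Nvec k"
    using d x by auto
qed

lemma
  assumes "x \<in> arr \<Lambda>" "y \<in> arr \<Lambda>" "src \<Lambda> x = rng \<Lambda> y"
  shows arr_comp: "comp \<Lambda> x y \<in> arr \<Lambda>"
    and rng_comp: "rng \<Lambda> (comp \<Lambda> x y) = rng \<Lambda> x" and src_comp: "src \<Lambda> (comp \<Lambda> x y) = src \<Lambda> y"
    and deg_comp: "deg \<Lambda> (comp \<Lambda> x y) = deg \<Lambda> x + deg \<Lambda> y"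
proof -
  have sc: "small_category \<Lambda>" and d: "\<forall>x\<in>arr \<Lambda>. \<forall>y\<in>arr \<Lambda>. src \<Lambda> x = rng \<Lambda> y \<longrightarrow>
      deg \<Lambda> (comp \<Lambda> x y) = deg \<Lambda> x + deg \<Lambda> y"
    using k_graph unfolding k_graph_def by - (elim conjE, assumption)+
  from sc have "comp \<Lambda> x y \<in> arr \<Lambda> \<and> rng \<Lambda> (comp \<Lambda> x y) = rng \<Lambda> x \<and> src \<Lambda> (comp \<Lambda> x y) = src \<Lambda> y"
    using assms unfolding small_category_def by simp
  then show "comp \<Lambda> x y \<in> arr \<Lambda>" "rng \<Lambda> (comp \<Lambda> x y) = rng \<Lambda> x" "src \<Lambda> (comp \<Lambda> x y) = src \<Lambda> y"
    by simp_all
  show "deg \<Lambda> (comp \<Lambda> x y) = deg \<Lambda> x + deg \<Lambda> y"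
    using d assms by simp
qed

lemma comp_assoc:
  assumes "x \<in> arr \<Lambda>" "y \<in> arr \<Lambda>" "z \<in> arr \<Lambda>" "src \<Lambda> x = rng \<Lambda> y" "src \<Lambda> y = rng \<Lambda> z"
  shows "comp \<Lambda> (comp \<Lambda> x y) z = comp \<Lambda> x (comp \<Lambda> y z)"
proof -
  have "small_category \<Lambda>"
    using k_graph unfolding k_graph_def by - (elim conjE, assumption)
  then show ?thesis
    using assms unfolding small_category_def by simp
qed

lemma factorisation:
  assumes "x \<in> arr \<Lambda>" "m \<in> Nvec k" "n \<in> Nvec k" "deg \<Lambda> x = m + n"
  shows "\<exists>!(\<mu>, \<nu>). \<mu> \<in> arr \<Lambda> \<and> \<nu> \<in> arr \<Lambda> \<and> src \<Lambda> \<mu> = rng \<Lambda> \<nu> \<and>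
           deg \<Lambda> \<mu> = m \<and> deg \<Lambda> \<nu> = n \<and> x = comp \<Lambda> \<mu> \<nu>"
proof -
  have "\<forall>x\<in>arr \<Lambda>. \<forall>m\<in>Nvec k. \<forall>n\<in>Nvec k. deg \<Lambda> x = m + n \<longrightarrow>
        (\<exists>!(\<mu>, \<nu>). \<mu> \<in> arr \<Lambda> \<and> \<nu> \<in> arr \<Lambda> \<and> src \<Lambda> \<mu> = rng \<Lambda> \<nu> \<and>
           deg \<Lambda> \<mu> = m \<and> deg \<Lambda> \<nu> = n \<and> x = comp \<Lambda> \<mu> \<nu>)"
    using k_graph unfolding k_graph_def by - (elim conjE, assumption)
  then show ?thesis
    using assms by blast
qed

lemma factorisation_exists:
  assumes "x \<in> arr \<Lambda>" "m \<le> deg \<Lambda> x"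
  obtains \<mu> \<nu> where "\<mu> \<in> arr \<Lambda>" "\<nu> \<in> arr \<Lambda>" "src \<Lambda> \<mu> = rng \<Lambda> \<nu>"
    "deg \<Lambda> \<mu> = m" "deg \<Lambda> \<nu> = deg \<Lambda> x - m" "x = comp \<Lambda> \<mu> \<nu>"
proof -
  have "deg \<Lambda> x = m + (deg \<Lambda> x - m)"
    using vec_add_diff[OF assms(2)] by simp
  from ex1_implies_ex[OF factorisation[OF assms(1) Nvec_le[OF assms(2)] Nvec_diff this]]
  show thesis
    using that deg_Nvec[OF assms(1)] by auto
qed

lemma factorisation_unique:
  assumes "\<mu> \<in> arr \<Lambda>" "\<nu> \<in> arr \<Lambda>" "src \<Lambda> \<mu> = rng \<Lambda> \<nu>"
    and "\<mu>' \<in> arr \<Lambda>" "\<nu>' \<in> arr \<Lambda>" "src \<Lambda> \<mu>' = rng \<Lambda> \<nu>'"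
    and eq: "comp \<Lambda> \<mu> \<nu> = comp \<Lambda> \<mu>' \<nu>'" and deg: "deg \<Lambda> \<mu> = deg \<Lambda> \<mu>'"
  shows "\<mu> = \<mu>'" "\<nu> = \<nu>'"
proof -
  have "deg \<Lambda> \<mu> + deg \<Lambda> \<nu> = deg \<Lambda> \<mu>' + deg \<Lambda> \<nu>'"
    using assms deg_comp by metis
  then have d: "deg \<Lambda> \<nu>' = deg \<Lambda> \<nu>"
    using deg by simp
  let ?P = "\<lambda>(\<alpha>, \<beta>). \<alpha> \<in> arr \<Lambda> \<and> \<beta> \<in> arr \<Lambda> \<and> src \<Lambda> \<alpha> = rng \<Lambda> \<beta> \<and>
           deg \<Lambda> \<alpha> = deg \<Lambda> \<mu> \<and> deg \<Lambda> \<beta> = deg \<Lambda> \<nu> \<and> comp \<Lambda> \<mu> \<nu> = comp \<Lambda> \<alpha> \<beta>"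
  have "\<exists>!z. ?P z"
    by (rule factorisation) (use assms d in \<open>auto simp: arr_comp deg_Nvec deg_comp\<close>)
  moreover have "?P (\<mu>, \<nu>)" "?P (\<mu>', \<nu>')"
    using assms d by simp_all
  moreover have "a = b" if "\<exists>!z. P z" "P a" "P b" for P and a b :: "'a \<times> 'a"
    using that by blast
  ultimately have "(\<mu>, \<nu>) = (\<mu>', \<nu>')"
    by presburger
  then show "\<mu> = \<mu>'" "\<nu> = \<nu>'"
    by auto
qed

text \<open>
  Both $r(x)\,x$ and $x\,s(x)$ factorise \<open>x\<close> into two factors of degree \<open>0\<close>, so
  uniqueness of factorisations makes the factors agree.
\<close>

lemma deg_0_imp_identity:
  assumes "x \<in> arr \<Lambda>" "deg \<Lambda> x = 0"
  shows "rng \<Lambda> x = x" "src \<Lambda> x = x"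
proof -
  note facts = arr_rng arr_src src_rng rng_src comp_rng comp_src deg_rng deg_src
  show "rng \<Lambda> x = x"
    by (rule factorisation_unique(1)[of _ x _ "src \<Lambda> x"]) (simp_all add: assms facts)
  show "src \<Lambda> x = x"
    by (rule factorisation_unique(2)[of x _ "rng \<Lambda> x"]) (simp_all add: assms facts)
qed

definition splits :: "'a \<Rightarrow> 'a \<Rightarrow> 'a \<Rightarrow> 'a \<Rightarrow> bool" where
  "splits x \<alpha> \<beta> \<gamma> \<longleftrightarrow> \<alpha> \<in> arr \<Lambda> \<and> \<beta> \<in> arr \<Lambda> \<and> \<gamma> \<in> arr \<Lambda> \<and> src \<Lambda> \<alpha> = rng \<Lambda> \<beta> \<and>
     src \<Lambda> \<beta> = rng \<Lambda> \<gamma> \<and> x = comp \<Lambda> \<alpha> (comp \<Lambda> \<beta> \<gamma>)"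

lemma splits_deg: "deg \<Lambda> x = deg \<Lambda> \<alpha> + deg \<Lambda> \<beta> + deg \<Lambda> \<gamma>" if "splits x \<alpha> \<beta> \<gamma>"
  using that by (auto simp: splits_def deg_comp arr_comp rng_comp add.assoc)

lemma splits_unique:
  assumes "splits x \<alpha> \<beta> \<gamma>" "splits x \<alpha>' \<beta>' \<gamma>'" "deg \<Lambda> \<alpha> = deg \<Lambda> \<alpha>'" "deg \<Lambda> \<beta> = deg \<Lambda> \<beta>'"
  shows "\<beta> = \<beta>'"
proof -
  have "comp \<Lambda> \<beta> \<gamma> = comp \<Lambda> \<beta>' \<gamma>'"
    using factorisation_unique(2)[of \<alpha> "comp \<Lambda> \<beta> \<gamma>" \<alpha>' "comp \<Lambda> \<beta>' \<gamma>'"] assms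
    by (simp add: splits_def arr_comp rng_comp)
  then show ?thesis
    using factorisation_unique(1)[of \<beta> \<gamma> \<beta>' \<gamma>'] assms by (simp add: splits_def)
qed

lemma segment_eqI:
  assumes s: "splits x \<alpha> \<beta> \<gamma>" and "deg \<Lambda> \<alpha> = m" "m + deg \<Lambda> \<beta> = n"
  shows "segment \<Lambda> x m n = \<beta>"
  unfolding segment_def
proof (rule the_equality)
  show "\<beta> \<in> arr \<Lambda> \<and> deg \<Lambda> \<beta> = n - m \<and>
     (\<exists>\<alpha>\<in>arr \<Lambda>. \<exists>\<gamma>\<in>arr \<Lambda>. deg \<Lambda> \<alpha> = m \<and> deg \<Lambda> \<gamma> = deg \<Lambda> x - n \<and>
        src \<Lambda> \<alpha> = rng \<Lambda> \<beta> \<and> src \<Lambda> \<beta> = rng \<Lambda> \<gamma> \<and> x = comp \<Lambda> \<alpha> (comp \<Lambda> \<beta> \<gamma>))"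
  proof -
    have "deg \<Lambda> \<beta> = n - m" "deg \<Lambda> \<gamma> = deg \<Lambda> x - n"
      using assms(2,3) splits_deg[OF s] by auto
    then show ?thesis
      using s assms(2) unfolding splits_def by blast
  qed
next
  fix \<beta>'
  assume "\<beta>' \<in> arr \<Lambda> \<and> deg \<Lambda> \<beta>' = n - m \<and>
     (\<exists>\<alpha>\<in>arr \<Lambda>. \<exists>\<gamma>\<in>arr \<Lambda>. deg \<Lambda> \<alpha> = m \<and> deg \<Lambda> \<gamma> = deg \<Lambda> x - n \<and>
        src \<Lambda> \<alpha> = rng \<Lambda> \<beta>' \<and> src \<Lambda> \<beta>' = rng \<Lambda> \<gamma> \<and> x = comp \<Lambda> \<alpha> (comp \<Lambda> \<beta>' \<gamma>))"
  then obtain \<alpha>' \<gamma>' where "splits x \<alpha>' \<beta>' \<gamma>'" "deg \<Lambda> \<alpha>' = m" "deg \<Lambda> \<beta>' = n - m"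
    unfolding splits_def by blast
  moreover have "deg \<Lambda> \<beta> = n - m"
    using assms(3) by auto
  ultimately show "\<beta>' = \<beta>"
    using splits_unique[OF _ s] assms by metis
qed

lemma segment_splits:
  assumes "x \<in> arr \<Lambda>" "m \<le> n" "n \<le> deg \<Lambda> x"
  obtains \<alpha> \<gamma> where "splits x \<alpha> (segment \<Lambda> x m n) \<gamma>" "deg \<Lambda> \<alpha> = m"
    "deg \<Lambda> (segment \<Lambda> x m n) = n - m" "deg \<Lambda> \<gamma> = deg \<Lambda> x - n"
proof -
  have "m \<le> deg \<Lambda> x"
    using assms by simp
  from factorisation_exists[OF assms(1) this] obtain \<alpha> \<delta> where 1: "\<alpha> \<in> arr \<Lambda>" "\<delta> \<in> arr \<Lambda>"
    "src \<Lambda> \<alpha> = rng \<Lambda> \<delta>" "deg \<Lambda> \<alpha> = m" "deg \<Lambda> \<delta> = deg \<Lambda> x - m" "x = comp \<Lambda> \<alpha> \<delta>" .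
  have "n - m \<le> deg \<Lambda> \<delta>"
    using assms 1(5) by (auto simp: le_fun_def diff_le_mono)
  from factorisation_exists[OF 1(2) this] obtain \<beta> \<gamma> where 2: "\<beta> \<in> arr \<Lambda>" "\<gamma> \<in> arr \<Lambda>"
    "src \<Lambda> \<beta> = rng \<Lambda> \<gamma>" "deg \<Lambda> \<beta> = n - m" "deg \<Lambda> \<gamma> = deg \<Lambda> \<delta> - (n - m)" "\<delta> = comp \<Lambda> \<beta> \<gamma>" .
  have s: "splits x \<alpha> \<beta> \<gamma>"
    using 1 2 by (auto simp: splits_def rng_comp)
  have "deg \<Lambda> \<gamma> = deg \<Lambda> x - n"
    using 1(5) 2(5) assms by (auto simp: fun_eq_iff le_fun_def)
  moreover have "segment \<Lambda> x m n = \<beta>"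
    using segment_eqI[OF s 1(4)] 2(4) vec_add_diff[OF assms(2)] by simp
  ultimately show thesis
    using that s 1(4) 2(4) by blast
qed

lemma
  assumes "x \<in> arr \<Lambda>" "m \<le> n" "n \<le> deg \<Lambda> x"
  shows arr_segment: "segment \<Lambda> x m n \<in> arr \<Lambda>"
    and deg_segment: "deg \<Lambda> (segment \<Lambda> x m n) = n - m"
  by (metis segment_splits[OF assms] splits_def)+

lemma segment_segment:
  assumes x: "x \<in> arr \<Lambda>" and "m \<le> n" "n \<le> deg \<Lambda> x" "a \<le> b" "b \<le> n - m"
  shows "segment \<Lambda> (segment \<Lambda> x m n) a b = segment \<Lambda> x (m + a) (m + b)"
proof -
  define \<beta> where "\<beta> = segment \<Lambda> x m n"
  obtain \<alpha> \<gamma> where 1: "splits x \<alpha> \<beta> \<gamma>" "deg \<Lambda> \<alpha> = m" "deg \<Lambda> \<beta> = n - m"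
    using segment_splits[OF assms(1-3)] \<beta>_def by metis
  have \<beta>: "\<beta> \<in> arr \<Lambda>" "b \<le> deg \<Lambda> \<beta>"
    using 1 assms by (auto simp: splits_def)
  obtain \<alpha>' \<gamma>' where 2: "splits \<beta> \<alpha>' (segment \<Lambda> \<beta> a b) \<gamma>'" "deg \<Lambda> \<alpha>' = a"
    "deg \<Lambda> (segment \<Lambda> \<beta> a b) = b - a"
    using segment_splits[OF \<beta>(1) assms(4) \<beta>(2)] by metis
  define \<sigma> where "\<sigma> = segment \<Lambda> \<beta> a b"
  have arrs: "\<alpha> \<in> arr \<Lambda>" "\<gamma> \<in> arr \<Lambda>" "\<alpha>' \<in> arr \<Lambda>" "\<sigma> \<in> arr \<Lambda>" "\<gamma>' \<in> arr \<Lambda>"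
    and ends: "src \<Lambda> \<alpha>' = rng \<Lambda> \<sigma>" "src \<Lambda> \<sigma> = rng \<Lambda> \<gamma>'" "src \<Lambda> \<alpha> = rng \<Lambda> \<beta>" "src \<Lambda> \<beta> = rng \<Lambda> \<gamma>"
    and x_eq: "x = comp \<Lambda> \<alpha> (comp \<Lambda> \<beta> \<gamma>)" and \<beta>_eq: "\<beta> = comp \<Lambda> \<alpha>' (comp \<Lambda> \<sigma> \<gamma>')"
    using 1(1) 2(1) unfolding splits_def \<sigma>_def[symmetric] by - (elim conjE, assumption)+
  have ends': "rng \<Lambda> \<beta> = rng \<Lambda> \<alpha>'" "src \<Lambda> \<beta> = src \<Lambda> \<gamma>'"
    using arrs ends(1,2) by (simp_all add: \<beta>_eq arr_comp rng_comp src_comp)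
  have "splits x (comp \<Lambda> \<alpha> \<alpha>') \<sigma> (comp \<Lambda> \<gamma>' \<gamma>)"
    using arrs ends ends' unfolding splits_def x_eq
    by (subst \<beta>_eq) (simp add: arr_comp rng_comp src_comp comp_assoc)
  moreover have "deg \<Lambda> (comp \<Lambda> \<alpha> \<alpha>') = m + a"
    using 1 2 arrs ends ends' by (simp add: deg_comp)
  moreover have "m + a + deg \<Lambda> \<sigma> = m + b"
    using 2(3) vec_add_diff[OF assms(4)] by (simp add: add.assoc \<sigma>_def)
  ultimately show ?thesis
    using segment_eqI \<beta>_def \<sigma>_def by metis
qed

lemma segment_whole: "segment \<Lambda> x 0 (deg \<Lambda> x) = x" if "x \<in> arr \<Lambda>"
proof -
  have "splits x (rng \<Lambda> x) x (src \<Lambda> x)"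
    using that
    by (simp add: splits_def arr_rng arr_src src_rng rng_src comp_rng comp_src)
  then show ?thesis
    by (rule segment_eqI) (use that in \<open>simp_all add: deg_rng\<close>)
qed

lemma segment_comp:
  assumes x: "x \<in> arr \<Lambda>" and "a \<le> b" "b \<le> c" "c \<le> deg \<Lambda> x"
  shows "src \<Lambda> (segment \<Lambda> x a b) = rng \<Lambda> (segment \<Lambda> x b c)"
    and "comp \<Lambda> (segment \<Lambda> x a b) (segment \<Lambda> x b c) = segment \<Lambda> x a c"
proof -
  have ac: "a \<le> c"
    using assms by simp
  define y where "y = segment \<Lambda> x a c"
  have y: "y \<in> arr \<Lambda>" "deg \<Lambda> y = c - a"
    unfolding y_def using arr_segment[OF x ac] deg_segment[OF x ac] assms by auto
  have le: "b - a \<le> c - a"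
    using assms by (auto simp: le_fun_def diff_le_mono)
  from factorisation_exists[OF y(1), of "b - a"] obtain \<mu> \<nu> where
    1: "\<mu> \<in> arr \<Lambda>" "\<nu> \<in> arr \<Lambda>" "src \<Lambda> \<mu> = rng \<Lambda> \<nu>" "deg \<Lambda> \<mu> = b - a"
       "deg \<Lambda> \<nu> = (c - a) - (b - a)" "y = comp \<Lambda> \<mu> \<nu>"
    using le y by metis
  have "splits y (rng \<Lambda> \<mu>) \<mu> \<nu>" "splits y \<mu> \<nu> (src \<Lambda> \<nu>)"
    using 1 by (auto simp: splits_def arr_rng arr_src src_rng rng_src comp_rng comp_src
        arr_comp rng_comp src_comp) (metis arr_comp comp_rng rng_comp)
  then have "segment \<Lambda> y 0 (b - a) = \<mu>" "segment \<Lambda> y (b - a) (c - a) = \<nu>"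
    using segment_eqI[of y "rng \<Lambda> \<mu>" \<mu> \<nu> 0 "b - a"] segment_eqI[of y \<mu> \<nu> "src \<Lambda> \<nu>" "b - a" "c - a"]
      1 vec_add_diff[OF le] by (auto simp: deg_rng)
  then have "segment \<Lambda> x a b = \<mu>" "segment \<Lambda> x b c = \<nu>"
    using segment_segment[OF x ac assms(4), of 0 "b - a"]
      segment_segment[OF x ac assms(4), of "b - a" "c - a"] le vec_add_diff[of a b]
      vec_add_diff[of a c] assms ac by (auto simp: y_def le_fun_def)
  then show "src \<Lambda> (segment \<Lambda> x a b) = rng \<Lambda> (segment \<Lambda> x b c)"
    and "comp \<Lambda> (segment \<Lambda> x a b) (segment \<Lambda> x b c) = segment \<Lambda> x a c"
    using 1 y_def by auto
qed

lemma segment_ends: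
  assumes x: "x \<in> arr \<Lambda>" and "a \<le> b" "b \<le> deg \<Lambda> x"
  shows "rng \<Lambda> (segment \<Lambda> x a b) = segment \<Lambda> x a a"
    and "src \<Lambda> (segment \<Lambda> x a b) = segment \<Lambda> x b b"
proof -
  have "deg \<Lambda> (segment \<Lambda> x a a) = 0" "deg \<Lambda> (segment \<Lambda> x b b) = 0"
      "segment \<Lambda> x a a \<in> arr \<Lambda>" "segment \<Lambda> x b b \<in> arr \<Lambda>"
    using deg_segment[OF x, of a a] deg_segment[OF x, of b b]
      arr_segment[OF x, of a a] arr_segment[OF x, of b b] assms
    by (auto simp: fun_eq_iff)
  then show "rng \<Lambda> (segment \<Lambda> x a b) = segment \<Lambda> x a a"
    and "src \<Lambda> (segment \<Lambda> x a b) = segment \<Lambda> x b b"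
    using segment_comp(1)[OF x, of a a b] segment_comp(1)[OF x, of a b b] assms
      deg_0_imp_identity by auto
qed


section \<open>Points of the realisation\<close>

lemma equiv_realisation_rel: "equiv (topspace (box_sum k \<Lambda>)) (realisation_rel k \<Lambda>)"
  by (rule equivI)
    (auto simp: refl_on_def sym_def realisation_rel_def intro!: transI)

lemma realisation_pt_eq_iff:
  assumes "(\<mu>, s) \<in> topspace (box_sum k \<Lambda>)" "(\<nu>, t) \<in> topspace (box_sum k \<Lambda>)"
  shows "realisation_pt k \<Lambda> \<mu> s = realisation_pt k \<Lambda> \<nu> t \<longleftrightarrow>
    (\<forall>i. s i - real (vfloor s i) = t i - real (vfloor t i)) \<and>
     segment \<Lambda> \<mu> (vfloor s) (vceiling s) = segment \<Lambda> \<nu> (vfloor t) (vceiling t)"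
  using eq_equiv_class_iff[OF equiv_realisation_rel assms] assms
  by (simp add: realisation_pt_def realisation_rel_def)

lemma topspace_box_sum: "topspace (box_sum k \<Lambda>) = {(x, t). x \<in> arr \<Lambda> \<and> t \<in> topspace (box k (deg \<Lambda> x))}"
  by (auto simp: box_sum_def)

lemma segment_point_in_box:
  assumes "x \<in> arr \<Lambda>" "m \<le> n" "n \<le> deg \<Lambda> x" "s \<in> topspace (box k (n - m))"
  shows "(\<lambda>i. real (m i) + s i) \<in> topspace (box k (deg \<Lambda> x))"
proof -
  have "\<forall>i. m i \<le> n i \<and> n i \<le> deg \<Lambda> x i" "m \<in> Nvec k"
    using assms Nvec_le[OF order_trans[OF assms(2,3)] deg_Nvec[OF assms(1)]] by (auto simp: le_fun_def)
  moreover have "\<forall>i. s i \<le> real (n i - m i)"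
    using assms(4) by (auto simp: topspace_box)
  ultimately have "real (m i) + s i \<le> real (deg \<Lambda> x i)" for i
    by (smt (verit) of_nat_diff of_nat_le_iff)
  then show ?thesis
    using assms(4) \<open>m \<in> Nvec k\<close> by (auto simp: topspace_box Nvec_def)
qed

text \<open>
  Translation by an integral vector preserves fractional parts and shifts floor and ceiling alike,
  so it identifies the box of a segment $\lambda(m, n)$ with $[m, n] \subseteq [0, d(\lambda)]$. The
  compatibility of \<open>cube_map\<close> with faces is an instance.
\<close>

lemma realisation_pt_segment:
  assumes x: "x \<in> arr \<Lambda>" and "m \<le> n" "n \<le> deg \<Lambda> x" and s: "s \<in> topspace (box k (n - m))"
  shows "realisation_pt k \<Lambda> (segment \<Lambda> x m n) s = realisation_pt k \<Lambda> x (\<lambda>i. real (m i) + s i)"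
proof -
  have s': "0 \<le> s i" "s i \<le> real (n i - m i)" for i
    using s by (auto simp: topspace_box)
  have fl: "vfloor (\<lambda>i. real (m i) + s i) = m + vfloor s"
    using s' by (auto simp: vfloor_def fun_eq_iff nat_add_distrib)
  have ce: "vceiling (\<lambda>i. real (m i) + s i) = m + vceiling s"
  proof
    fix i
    have "0 \<le> \<lceil>s i\<rceil>" "\<lceil>real (m i) + s i\<rceil> = int (m i) + \<lceil>s i\<rceil>"
      using s'(1)[of i] by linarith+
    then show "vceiling (\<lambda>i. real (m i) + s i) i = (m + vceiling s) i"
      by (simp add: vceiling_def nat_add_distrib)
  qed
  have fc: "vfloor s \<le> vceiling s"
    by (auto simp: vceiling_def vfloor_def le_fun_def intro!: nat_mono floor_le_ceiling)
  have cd: "vceiling s \<le> n - m"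
    using s' by (auto simp: vceiling_def le_fun_def ceiling_le_iff)
  have "segment \<Lambda> (segment \<Lambda> x m n) (vfloor s) (vceiling s) = segment \<Lambda> x (m + vfloor s) (m + vceiling s)"
    by (rule segment_segment[OF x assms(2,3) fc cd])
  moreover have "(segment \<Lambda> x m n, s) \<in> topspace (box_sum k \<Lambda>)"
    using arr_segment[OF assms(1-3)] deg_segment[OF assms(1-3)] s by (simp add: topspace_box_sum)
  moreover have "(x, \<lambda>i. real (m i) + s i) \<in> topspace (box_sum k \<Lambda>)"
    using segment_point_in_box[OF assms] x by (simp add: topspace_box_sum)
  ultimately show ?thesis
    by (subst realisation_pt_eq_iff) (auto simp: fl ce)
qed

end


section \<open>Admissible homomorphisms\<close>

lemma gen_eq_iff [simp]: "gen i = gen j \<longleftrightarrow> i = j"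
  by (auto simp: gen_def fun_eq_iff)

lemma gen_neq_0 [simp]: "gen i \<noteq> 0" "0 \<noteq> gen i"
  by (auto simp: gen_def fun_eq_iff)

lemma gen_Nvec: "i < r \<Longrightarrow> gen i \<in> Nvec r"
  by (auto simp: gen_def Nvec_def)

lemma ones_Nvec: "ones r \<in> Nvec r"
  by (auto simp: ones_def Nvec_def)

lemma gen_le_ones: "i < r \<Longrightarrow> gen i \<le> ones r"
  by (auto simp: gen_def ones_def le_fun_def)

text \<open>
  The index sequences of the definition list, in increasing order, the generators that are not
  killed. Stated generator by generator, admissibility is stable under inserting and deleting
  coordinates.
\<close>

lemma admissible_iff:
  "admissible r k h \<longleftrightarrow> Nvec_hom r k h \<and>
     (\<forall>i<r. h (gen i) = 0 \<or> (\<exists>j<k. h (gen i) = gen j)) \<and>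
     (\<forall>i i' j j'. i < i' \<and> i' < r \<and> h (gen i) = gen j \<and> h (gen i') = gen j' \<longrightarrow> j < j')"
    (is "_ \<longleftrightarrow> _ \<and> ?single \<and> ?mono")
proof
  assume "admissible r k h"
  then obtain t :: nat and i j :: "nat \<Rightarrow> nat" where hom: "Nvec_hom r k h"
    and i: "i \<in> {..<t} \<rightarrow> {..<r}" "strict_mono_on {..<t} i"
    and j: "j \<in> {..<t} \<rightarrow> {..<k}" "strict_mono_on {..<t} j"
    and h1: "\<forall>p<t. h (gen (i p)) = gen (j p)"
    and h0: "\<forall>q\<in>{..<r} - i ` {..<t}. h (gen q) = 0"
    unfolding admissible_def by (elim conjE exE) (rule that)
  have *: "\<exists>p<t. q = i p" if "q < r" "h (gen q) \<noteq> 0" for q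
    using h0 that by blast
  have ?single
    using * h1 j(1) by (metis PiE lessThan_iff)
  moreover have ?mono
  proof (intro allI impI)
    fix a a' b b'
    assume A: "a < a' \<and> a' < r \<and> h (gen a) = gen b \<and> h (gen a') = gen b'"
    then obtain p p' where p: "p < t" "a = i p" "p' < t" "a' = i p'"
      using *[of a] *[of a'] by auto
    have "p < p'"
      using A p i(2) by (metis lessThan_iff linorder_neqE_nat order_less_imp_not_less strict_mono_onD)
    then have "j p < j p'"
      using j(2) p by (auto simp: strict_mono_on_def)
    moreover have "b = j p" "b' = j p'"
      using A p h1 by (metis gen_eq_iff)+
    ultimately show "b < b'" by simp
  qed
  ultimately show "Nvec_hom r k h \<and> ?single \<and> ?mono"
    using hom by blast
next
  assume A: "Nvec_hom r k h \<and> ?single \<and> ?mono"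
  define S where "S = {i. i < r \<and> h (gen i) \<noteq> 0}"
  define L where "L = sorted_list_of_set S"
  have fin: "finite S"
    by (simp add: S_def)
  then have L: "set L = S" "sorted_wrt (<) L"
    by (simp_all add: L_def)
  have "\<forall>i\<in>S. \<exists>j<k. h (gen i) = gen j"
    using A[THEN conjunct2, THEN conjunct1] unfolding S_def by blast
  then obtain J where J: "\<forall>i\<in>S. J i < k \<and> h (gen i) = gen (J i)"
    by metis
  have nth: "L ! p \<in> S" if "p < length L" for p
    using that L(1) by auto
  have mono: "L ! p < L ! p'" if "p < p'" "p' < length L" for p p'
    using sorted_wrt_nth_less[OF L(2)] that by blast
  show "admissible r k h"
    unfolding admissible_def
  proof (intro conjI exI)
    show "(\<lambda>p. L ! p) \<in> {..<length L} \<rightarrow> {..<r}"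
      using nth by (auto simp: S_def)
    show "strict_mono_on {..<length L} (\<lambda>p. L ! p)"
      using mono by (auto simp: strict_mono_on_def)
    show "(\<lambda>p. J (L ! p)) \<in> {..<length L} \<rightarrow> {..<k}"
      using nth J by auto
    show "strict_mono_on {..<length L} (\<lambda>p. J (L ! p))"
      unfolding strict_mono_on_def
    proof (intro allI impI)
      fix p p'
      assume "p \<in> {..<length L} \<and> p' \<in> {..<length L} \<and> p < p'"
      then have L': "L ! p < L ! p'" "L ! p \<in> S" "L ! p' \<in> S"
        using mono nth by auto
      from L'(2,3) have hJ: "h (gen (L ! p)) = gen (J (L ! p))" "h (gen (L ! p')) = gen (J (L ! p'))"
        using J by blast+
      from L'(3) have "L ! p' < r"
        by (simp add: S_def)
      with L'(1) hJ show "J (L ! p) < J (L ! p')"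
        by - (rule A[THEN conjunct2, THEN conjunct2, THEN spec, THEN spec, THEN spec, THEN spec, THEN mp],
            intro conjI)
    qed
    show "\<forall>p<length L. h (gen (L ! p)) = gen (J (L ! p))"
      using nth J by auto
    have "(!) L ` {..<length L} = S"
      using L(1) by (auto simp: set_conv_nth)
    then show "\<forall>q\<in>{..<r} - (!) L ` {..<length L}. h (gen q) = 0"
      by (auto simp: S_def)
  qed (use A in blast)
qed

lemma admissible_hom: "admissible r k h \<Longrightarrow> Nvec_hom r k h"
  by (simp add: admissible_def)

lemma Nvec_hom_add:
  "Nvec_hom r k h \<Longrightarrow> p \<in> Nvec r \<Longrightarrow> q \<in> Nvec r \<Longrightarrow> h (p + q) = h p + h q"
  by (simp add: Nvec_hom_def)

lemma Nvec_hom_0: "Nvec_hom r k h \<Longrightarrow> h 0 = 0"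
  by (simp add: Nvec_hom_def)

lemma Nvec_hom_Nvec: "Nvec_hom r k h \<Longrightarrow> p \<in> Nvec r \<Longrightarrow> h p \<in> Nvec k"
  by (auto simp: Nvec_hom_def)

lemma Nvec_hom_le:
  assumes "Nvec_hom r k h" "p \<le> q" "q \<in> Nvec r"
  shows "h p \<le> h q" "h (q - p) = h q - h p"
proof -
  have "h q = h p + h (q - p)"
    using Nvec_hom_add[OF assms(1) Nvec_le[OF assms(2,3)] Nvec_diff[OF assms(3)]]
      vec_add_diff[OF assms(2)] by metis
  then show "h p \<le> h q" "h (q - p) = h q - h p"
    by (auto simp: le_fun_def)
qed

lemma Nvec_hom_eq_sum:
  assumes h: "Nvec_hom r k h" and "p \<in> Nvec r"
  shows "h p a = (\<Sum>i<r. p i * h (gen i) a)"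
proof -
  have mult: "h (\<lambda>j. if j = m then c else 0) a = c * h (gen m) a" if m: "m < r" for m c
  proof (induction c)
    case 0
    have "(\<lambda>j. if j = m then 0 else 0) = (0 :: nat \<Rightarrow> nat)"
      by auto
    then show ?case
      using Nvec_hom_0[OF h] by simp
  next
    case (Suc c)
    have "(\<lambda>j. if j = m then Suc c else 0) = (\<lambda>j. if j = m then c else 0) + gen m"
      by (auto simp: gen_def fun_eq_iff)
    moreover have "(\<lambda>j. if j = m then c else 0) \<in> Nvec r"
      using m by (auto simp: Nvec_def)
    ultimately show ?case
      using Suc Nvec_hom_add[OF h _ gen_Nvec[OF m]] by simp
  qed
  have "h p a = (\<Sum>i<m. p i * h (gen i) a)" if "m \<le> r" "p \<in> Nvec m" for m p
    using that
  proof (induction m arbitrary: p)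
    case 0
    then have "p = 0"
      by (auto simp: Nvec_def)
    then show ?case
      using Nvec_hom_0[OF h] by (simp add: zero_fun_def)
  next
    case (Suc m)
    define p' where "p' = (\<lambda>j. if j = m then 0 else p j)"
    define e where "e = (\<lambda>j. if j = m then p m else 0)"
    have "p = p' + e"
      by (auto simp: p'_def e_def)
    moreover have p': "p' \<in> Nvec m" "p' \<in> Nvec r" "e \<in> Nvec r"
      using Suc.prems by (auto simp: Nvec_def p'_def e_def)
    ultimately have "h p a = h p' a + h e a"
      using Nvec_hom_add[OF h] by simp
    also have "h e a = p m * h (gen m) a"
      unfolding e_def using mult Suc.prems by simp
    also have "h p' a = (\<Sum>i<m. p' i * h (gen i) a)"
      using Suc.IH[OF _ p'(1)] Suc.prems by simp
    also have "\<dots> = (\<Sum>i<m. p i * h (gen i) a)"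
      by (rule sum.cong) (auto simp: p'_def)
    finally show ?case by simp
  qed
  then show ?thesis
    using assms(2) by blast
qed

lemma hom_extend_of_nat:
  "Nvec_hom r k h \<Longrightarrow> p \<in> Nvec r \<Longrightarrow> hom_extend r h (\<lambda>i. real (p i)) = (\<lambda>a. real (h p a))"
  by (simp add: hom_extend_def Nvec_hom_eq_sum)

lemma hom_extend_in_box:
  assumes h: "Nvec_hom r k h" and t: "t \<in> topspace (unit_box r)"
  shows "hom_extend r h t \<in> topspace (box k (h (ones r)))"
proof -
  have t': "0 \<le> t i" "t i \<le> 1" for i
    using t by (auto simp: topspace_box ones_def split: if_splits)
  have "hom_extend r h t a \<le> real (h (ones r) a)" for a
  proof -
    have "hom_extend r h t a \<le> (\<Sum>i<r. 1 * real (h (gen i) a))"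
      unfolding hom_extend_def by (intro sum_mono mult_right_mono t') simp
    also have "\<dots> = real (h (ones r) a)"
      by (simp only: Nvec_hom_eq_sum[OF h ones_Nvec]) (simp add: ones_def)
    finally show ?thesis .
  qed
  moreover have "0 \<le> hom_extend r h t a" for a
    unfolding hom_extend_def by (intro sum_nonneg mult_nonneg_nonneg t') simp
  moreover have "hom_extend r h t a = 0" if "a \<ge> k" for a
    using Nvec_hom_Nvec[OF h gen_Nvec] that by (auto simp: hom_extend_def Nvec_def intro!: sum.neutral)
  ultimately show ?thesis
    by (auto simp: topspace_box)
qed

lemma continuous_map_box_coord: "continuous_map (box k n) euclideanreal (\<lambda>t. t i)"
  unfolding box_def Euclidean_space_def
  by (intro continuous_map_from_subtopology continuous_map_product_projection) simp

lemma continuous_map_into_box: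
  assumes "\<And>i. continuous_map X euclideanreal (\<lambda>x. f x i)"
    and "f ` topspace X \<subseteq> topspace (box k n)"
  shows "continuous_map X (box k n) f"
  using assms unfolding box_def Euclidean_space_def
  by (auto simp: continuous_map_in_subtopology continuous_map_componentwise_UNIV)

lemma continuous_map_hom_extend:
  assumes h: "Nvec_hom r k h"
  shows "continuous_map (unit_box r) (box k (h (ones r))) (hom_extend r h)"
proof (rule continuous_map_into_box)
  show "continuous_map (unit_box r) euclideanreal (\<lambda>t. hom_extend r h t i)" for i
    unfolding hom_extend_def
    by (intro continuous_map_sum continuous_map_real_mult continuous_map_box_coord) auto
qed (use hom_extend_in_box[OF h] in blast)


section \<open>Inserting and deleting a coordinate\<close>

lemma insert_delete_coord: "insert_coord i (t i) (delete_coord i t) = t"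
  by (auto simp: insert_coord_def delete_coord_def fun_eq_iff)

text \<open>
  The position to which coordinate \<open>j\<close> moves when a new coordinate is inserted at \<open>i\<close>.
\<close>

definition skip :: "nat \<Rightarrow> nat \<Rightarrow> nat" where
  "skip i j = (if j < i then j else Suc j)"

lemma insert_coord_skip [simp]: "insert_coord i c t (skip i j) = t j"
  by (simp add: insert_coord_def skip_def)

lemma insert_coord_same [simp]: "insert_coord i c t i = c"
  by (simp add: insert_coord_def)

lemma skip_less: "skip i j < skip i j' \<longleftrightarrow> j < j'"
  by (auto simp: skip_def)

lemma sum_skip:
  fixes f :: "nat \<Rightarrow> 'b::comm_monoid_add"
  assumes "i \<le> r"
  shows "(\<Sum>j<Suc r. f j) = f i + (\<Sum>j<r. f (skip i j))"
proof -
  have "{..<Suc r} = insert i (skip i ` {..<r})"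
  proof (intro equalityI subsetI)
    fix x
    assume x: "x \<in> {..<Suc r}"
    show "x \<in> insert i (skip i ` {..<r})"
    proof (cases "x = i")
      case False
      then have "x = skip i (if x < i then x else x - 1)" "(if x < i then x else x - 1) < r"
        using x assms by (auto simp: skip_def)
      then show ?thesis by blast
    qed simp
  qed (use assms in \<open>auto simp: skip_def\<close>)
  moreover have "inj_on (skip i) {..<r}" "i \<notin> skip i ` {..<r}"
    by (auto simp: skip_def inj_on_def split: if_splits)
  ultimately show ?thesis
    by (simp add: sum.reindex)
qed

lemma insert_coord_gen: "insert_coord i 0 (gen j) = gen (skip i j)"
  by (auto simp: insert_coord_def gen_def skip_def fun_eq_iff)

lemma delete_coord_gen: "delete_coord i (gen (skip i j)) = gen j"
  by (auto simp: delete_coord_def gen_def skip_def fun_eq_iff)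

lemma delete_coord_gen_same: "delete_coord i (gen i) = 0"
  by (auto simp: delete_coord_def gen_def fun_eq_iff)

lemma insert_coord_Nvec: "p \<in> Nvec r \<Longrightarrow> i \<le> r \<Longrightarrow> insert_coord i c p \<in> Nvec (Suc r)"
  by (auto simp: insert_coord_def Nvec_def)

lemma delete_coord_Nvec: "p \<in> Nvec (Suc r) \<Longrightarrow> i \<le> r \<Longrightarrow> delete_coord i p \<in> Nvec r"
  by (auto simp: delete_coord_def Nvec_def)

lemma Nvec_hom_insert:
  assumes "Nvec_hom (Suc r) k h" "i \<le> r"
  shows "Nvec_hom r k (\<lambda>p. h (insert_coord i 0 p))"
proof -
  have "insert_coord i 0 (m + n) = insert_coord i 0 m + insert_coord i 0 n"
      "insert_coord i 0 0 = (0 :: nat \<Rightarrow> nat)" for m n :: "nat \<Rightarrow> nat"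
    by (auto simp: insert_coord_def fun_eq_iff)
  then show ?thesis
    using assms insert_coord_Nvec[of _ r i 0] unfolding Nvec_hom_def by auto
qed

lemma Nvec_hom_delete:
  assumes "Nvec_hom r k h" "i \<le> r"
  shows "Nvec_hom (Suc r) k (\<lambda>p. h (delete_coord i p))"
proof -
  have "delete_coord i (m + n) = delete_coord i m + delete_coord i n"
      "delete_coord i 0 = (0 :: nat \<Rightarrow> nat)" for m n :: "nat \<Rightarrow> nat"
    by (auto simp: delete_coord_def fun_eq_iff)
  then show ?thesis
    using assms delete_coord_Nvec[of _ r i] unfolding Nvec_hom_def by auto
qed

lemma admissible_insert:
  assumes h: "admissible (Suc r) k h" and i: "i \<le> r"
  shows "admissible r k (\<lambda>p. h (insert_coord i 0 p))"
proof -
  have "skip i a < Suc r" if "a < r" for a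
    using that by (auto simp: skip_def)
  then show ?thesis
    using h Nvec_hom_insert[OF admissible_hom[OF h] i] skip_less[of i]
    unfolding admissible_iff insert_coord_gen by meson
qed

lemma skip_cases:
  assumes "a \<noteq> i"
  obtains b where "a = skip i b"
proof -
  have "a = skip i (if a < i then a else a - 1)"
    using assms by (auto simp: skip_def)
  then show thesis
    by (rule that)
qed

lemma admissible_delete:
  assumes h: "admissible r k h" and i: "i \<le> r"
  shows "admissible (Suc r) k (\<lambda>p. h (delete_coord i p))"
proof -
  have h0: "h 0 = 0"
    using Nvec_hom_0[OF admissible_hom[OF h]] .
  have less: "b < r" if "skip i b < Suc r" for b
    using that i by (auto simp: skip_def split: if_splits)
  show ?thesis
    unfolding admissible_iff
  proof (intro conjI allI impI)
    fix a
    assume "a < Suc r"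
    then show "h (delete_coord i (gen a)) = 0 \<or> (\<exists>j<k. h (delete_coord i (gen a)) = gen j)"
      using h less h0 unfolding admissible_iff
      by (metis skip_cases delete_coord_gen delete_coord_gen_same)
  next
    fix a a' j j'
    assume A: "a < a' \<and> a' < Suc r \<and> h (delete_coord i (gen a)) = gen j \<and>
      h (delete_coord i (gen a')) = gen j'"
    then have "a \<noteq> i" "a' \<noteq> i"
      using h0 by (auto simp: delete_coord_gen_same)
    then obtain b b' where b: "a = skip i b" "a' = skip i b'"
      by (metis skip_cases)
    then have "b < b'" "b' < r" "h (gen b) = gen j" "h (gen b') = gen j'"
      using A less by (auto simp: delete_coord_gen skip_less)
    then show "j < j'"
      using h unfolding admissible_iff by blast
  qed (rule Nvec_hom_delete[OF admissible_hom[OF h] i])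
qed

lemma hom_extend_insert:
  assumes "i \<le> r"
  shows "hom_extend (Suc r) h (insert_coord i c t) =
    (\<lambda>a. c * real (h (gen i) a) + hom_extend r (\<lambda>p. h (insert_coord i 0 p)) t a)"
  by (simp only: hom_extend_def sum_skip[OF assms] insert_coord_skip insert_coord_same insert_coord_gen)

lemma hom_extend_delete:
  assumes "i \<le> r" "h 0 = 0"
  shows "hom_extend (Suc r) (\<lambda>p. h (delete_coord i p)) t = hom_extend r h (delete_coord i t)"
proof -
  have "t (skip i j) = delete_coord i t j" for j
    by (simp add: skip_def delete_coord_def)
  then show ?thesis
    by (simp only: hom_extend_def sum_skip[OF assms(1)] delete_coord_gen delete_coord_gen_same assms(2))
       simp
qed


section \<open>Cubes, faces and degeneracies\<close>

lemma cube_graph_arr: "(p, q) \<in> arr (cube_graph r) \<longleftrightarrow> p \<le> q \<and> q \<le> ones r"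
  using Nvec_le[OF _ ones_Nvec] by (fastforce simp: cube_graph_def)

lemma cube_graph_simps [simp]:
  "rng (cube_graph r) (p, q) = (p, p)" "src (cube_graph r) (p, q) = (q, q)"
  "comp (cube_graph r) (p, q) (q', u) = (p, u)" "deg (cube_graph r) (p, q) = q - p"
  by (simp_all add: cube_graph_def)

lemma cubes_functor: "\<phi> \<in> cubes k \<Lambda> r \<Longrightarrow> cat_functor (cube_graph r) \<Lambda> \<phi>"
  by (simp add: cubes_def quasimorphism_def)

lemma cubesI:
  assumes "\<phi> \<in> extensional (arr (cube_graph r))" "cat_functor (cube_graph r) \<Lambda> \<phi>"
    "admissible_for k \<Lambda> r \<phi> h"
  shows "\<phi> \<in> cubes k \<Lambda> r"
  using assms by (auto simp: cubes_def quasimorphism_def admissible_for_def dest: admissible_hom)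

lemma cubes_admissible:
  assumes "\<phi> \<in> cubes k \<Lambda> r"
  obtains h where "admissible_for k \<Lambda> r \<phi> h"
  using assms by (auto simp: cubes_def)

lemma admissible_for_deg:
  "admissible_for k \<Lambda> r \<phi> h \<Longrightarrow> p \<le> q \<Longrightarrow> q \<le> ones r \<Longrightarrow> deg \<Lambda> (\<phi> (p, q)) = h (q - p)"
  using cube_graph_arr by (fastforce simp: admissible_for_def)

lemma admissible_for_hom: "admissible_for k \<Lambda> r \<phi> h \<Longrightarrow> Nvec_hom r k h"
  by (simp add: admissible_for_def admissible_hom)

lemma zero_le_vec [simp]: "0 \<le> p" for p :: "nat \<Rightarrow> nat"
  by (simp add: le_fun_def)

text \<open>
  Any admissible map associated to \<open>\<phi>\<close> may be used, because its value on a generator \<open>gen i\<close> is the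
  degree of \<open>\<phi> (0, gen i)\<close>.
\<close>

lemma cube_map_eq:
  assumes "admissible_for k \<Lambda> r \<phi> h"
  shows "cube_map k \<Lambda> r \<phi> t = realisation_pt k \<Lambda> (\<phi> (0, ones r)) (hom_extend r h t)"
proof -
  define h' where "h' = (SOME h. admissible_for k \<Lambda> r \<phi> h)"
  have "admissible_for k \<Lambda> r \<phi> h'"
    unfolding h'_def using someI[of "admissible_for k \<Lambda> r \<phi>", OF assms] .
  then have "h' (gen i) = h (gen i)" if "i < r" for i
    using admissible_for_deg[OF _ zero_le_vec gen_le_ones[OF that]] assms by (metis diff_zero)
  then show ?thesis
    by (simp add: cube_map_def h'_def[symmetric] hom_extend_def)
qed

text \<open>
  A monotone map \<open>f\<close> between the vertex sets of two cubes induces a functor between the cube graphs;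
  faces and degeneracies are the instances where \<open>f\<close> inserts or deletes a coordinate.
\<close>

lemma cat_functor_pullback:
  assumes \<phi>: "cat_functor (cube_graph s) \<Lambda> \<phi>"
    and f: "\<And>p q. p \<le> q \<Longrightarrow> q \<le> ones r \<Longrightarrow> f p \<le> f q \<and> f q \<le> ones s"
  shows "cat_functor (cube_graph r) \<Lambda> (restrict (\<lambda>(p, q). \<phi> (f p, f q)) (arr (cube_graph r)))"
proof -
  have arr: "(f p, f q) \<in> arr (cube_graph s)" if "p \<le> q" "q \<le> ones r" for p q
    using f that by (simp add: cube_graph_arr)
  note F = \<phi>[unfolded cat_functor_def]
  show ?thesis
    unfolding cat_functor_def
  proof (intro conjI ballI impI)
    show "restrict (\<lambda>(p, q). \<phi> (f p, f q)) (arr (cube_graph r)) \<in> arr (cube_graph r) \<rightarrow> arr \<Lambda>"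
      using funcset_mem[OF F[THEN conjunct1] arr] by (auto simp: cube_graph_arr)
  next
    fix x
    assume "x \<in> arr (cube_graph r)"
    then obtain p q where x: "x = (p, q)" "p \<le> q" "q \<le> ones r"
      by (metis cube_graph_arr surj_pair)
    then have "p \<le> ones r"
      by simp
    then show "restrict (\<lambda>(p, q). \<phi> (f p, f q)) (arr (cube_graph r)) (rng (cube_graph r) x) =
        rng \<Lambda> (restrict (\<lambda>(p, q). \<phi> (f p, f q)) (arr (cube_graph r)) x)"
      and "restrict (\<lambda>(p, q). \<phi> (f p, f q)) (arr (cube_graph r)) (src (cube_graph r) x) =
        src \<Lambda> (restrict (\<lambda>(p, q). \<phi> (f p, f q)) (arr (cube_graph r)) x)"
      using F[THEN conjunct2, THEN conjunct1, rule_format, OF arr[OF x(2,3)]] x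
      by (simp_all add: cube_graph_arr)
  next
    fix x y
    assume "x \<in> arr (cube_graph r)" "y \<in> arr (cube_graph r)" "src (cube_graph r) x = rng (cube_graph r) y"
    then obtain p q u where x: "x = (p, q)" "y = (q, u)" "p \<le> q" "q \<le> u" "u \<le> ones r"
      by (cases x; cases y) (auto simp: cube_graph_arr)
    then have "p \<le> u" "q \<le> ones r"
      by simp_all
    then show "restrict (\<lambda>(p, q). \<phi> (f p, f q)) (arr (cube_graph r)) (comp (cube_graph r) x y) =
        comp \<Lambda> (restrict (\<lambda>(p, q). \<phi> (f p, f q)) (arr (cube_graph r)) x)
          (restrict (\<lambda>(p, q). \<phi> (f p, f q)) (arr (cube_graph r)) y)"
      using F[THEN conjunct2, THEN conjunct2, rule_format, OF arr[of p q] arr[of q u]] x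
      by (simp add: cube_graph_arr)
  qed
qed

lemma insert_coord_mono:
  assumes "p \<le> q" "q \<le> ones r" "i \<le> r" "l \<in> {0, 1}"
  shows "insert_coord i l p \<le> insert_coord i l q \<and> insert_coord i l q \<le> ones (Suc r)"
  using assms(3,4) assms(1)[unfolded le_fun_def] assms(2)[unfolded le_fun_def ones_def]
  by (auto simp: insert_coord_def le_fun_def ones_def split: if_splits)
     (metis One_nat_def Suc_less_eq Suc_pred less_Suc_eq_0_disj linorder_not_less not_gr_zero)+

lemma delete_coord_mono:
  assumes "p \<le> q" "q \<le> ones (Suc r)" "i \<le> r"
  shows "delete_coord i p \<le> delete_coord i q \<and> delete_coord i q \<le> ones r"
proof -
  have q: "q j \<le> (if j < Suc r then 1 else 0)" for j
    using assms(2) by (simp add: le_fun_def ones_def)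
  have "delete_coord i q j \<le> ones r j" for j
    using q[of j] q[of "Suc j"] assms(3) by (auto simp: delete_coord_def ones_def split: if_splits)
  moreover have "delete_coord i p j \<le> delete_coord i q j" for j
    using assms(1) by (simp add: delete_coord_def le_fun_def)
  ultimately show ?thesis
    by (simp add: le_fun_def)
qed

lemma face_app:
  "p \<le> q \<Longrightarrow> q \<le> ones r \<Longrightarrow> face r i l \<phi> (p, q) = \<phi> (insert_coord i l p, insert_coord i l q)"
  by (simp add: face_def cube_graph_arr)

lemma degeneracy_app:
  "p \<le> q \<Longrightarrow> q \<le> ones (Suc r) \<Longrightarrow> degeneracy r i \<phi> (p, q) = \<phi> (delete_coord i p, delete_coord i q)"
  by (simp add: degeneracy_def cube_graph_arr)

lemma face_cube:
  assumes \<phi>: "\<phi> \<in> cubes k \<Lambda> (Suc r)" and h: "admissible_for k \<Lambda> (Suc r) \<phi> h"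
    and i: "i \<le> r" and l: "l \<in> {0, 1}"
  shows "face r i l \<phi> \<in> cubes k \<Lambda> r"
    and "admissible_for k \<Lambda> r (face r i l \<phi>) (\<lambda>p. h (insert_coord i 0 p))"
proof -
  have "deg \<Lambda> (face r i l \<phi> (p, q)) = h (insert_coord i 0 (q - p))" if "p \<le> q" "q \<le> ones r" for p q
  proof -
    have "insert_coord i l q - insert_coord i l p = insert_coord i 0 (q - p)"
      by (auto simp: insert_coord_def fun_eq_iff)
    then show ?thesis
      using insert_coord_mono[OF that i l] admissible_for_deg[OF h] face_app[OF that] by metis
  qed
  then show *: "admissible_for k \<Lambda> r (face r i l \<phi>) (\<lambda>p. h (insert_coord i 0 p))"
    using h i admissible_insert[of r k h i] by (auto simp: admissible_for_def cube_graph_arr)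
  show "face r i l \<phi> \<in> cubes k \<Lambda> r"
    by (rule cubesI[OF _ _ *])
      (use cat_functor_pullback[OF cubes_functor[OF \<phi>]] insert_coord_mono[OF _ _ i l] in
        \<open>auto simp: face_def\<close>)
qed

lemma admissible_for_degeneracy:
  assumes h: "admissible_for k \<Lambda> r \<phi> h" and i: "i \<le> r"
  shows "admissible_for k \<Lambda> (Suc r) (degeneracy r i \<phi>) (\<lambda>p. h (delete_coord i p))"
proof -
  have "deg \<Lambda> (degeneracy r i \<phi> (p, q)) = h (delete_coord i (q - p))"
    if "p \<le> q" "q \<le> ones (Suc r)" for p q
  proof -
    have "delete_coord i q - delete_coord i p = delete_coord i (q - p)"
      by (auto simp: delete_coord_def fun_eq_iff)
    then show ?thesis
      using delete_coord_mono[OF that i] admissible_for_deg[OF h] degeneracy_app[OF that] by metis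
  qed
  then show ?thesis
    using h i admissible_delete[of r k h i] by (auto simp: admissible_for_def cube_graph_arr)
qed

context higher_rank_graph
begin

lemma cube_top:
  assumes \<phi>: "\<phi> \<in> cubes k \<Lambda> r" and h: "admissible_for k \<Lambda> r \<phi> h"
  shows "\<phi> (0, ones r) \<in> arr \<Lambda>" "deg \<Lambda> (\<phi> (0, ones r)) = h (ones r)"
proof -
  have "(0, ones r) \<in> arr (cube_graph r)"
    by (simp add: cube_graph_arr)
  then show "\<phi> (0, ones r) \<in> arr \<Lambda>"
    using cubes_functor[OF \<phi>] unfolding cat_functor_def by blast
  show "deg \<Lambda> (\<phi> (0, ones r)) = h (ones r)"
    using admissible_for_deg[OF h, of 0 "ones r"] by simp
qed

text \<open>
  A cube is determined by its longest morphism and its admissible map, because the functor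
  takes the factorisation of \<open>(0, ones r)\<close> through \<open>p\<close> and \<open>q\<close> to a factorisation in \<open>\<Lambda>\<close>.
\<close>

lemma cube_segment:
  assumes \<phi>: "\<phi> \<in> cubes k \<Lambda> r" and h: "admissible_for k \<Lambda> r \<phi> h" and pq: "p \<le> q" "q \<le> ones r"
  shows "\<phi> (p, q) = segment \<Lambda> (\<phi> (0, ones r)) (h p) (h q)"
proof -
  note F = cubes_functor[OF \<phi>, unfolded cat_functor_def]
  note F_ends = F[THEN conjunct2, THEN conjunct1, rule_format]
  note F_comp = F[THEN conjunct2, THEN conjunct2, rule_format]
  have p: "p \<le> ones r"
    using pq by simp
  have arr: "(0, p) \<in> arr (cube_graph r)" "(p, q) \<in> arr (cube_graph r)" "(q, ones r) \<in> arr (cube_graph r)"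
    "(p, ones r) \<in> arr (cube_graph r)"
    using pq p by (simp_all add: cube_graph_arr)
  have "\<phi> (p, ones r) = comp \<Lambda> (\<phi> (p, q)) (\<phi> (q, ones r))"
    using F_comp[OF arr(2,3)] by simp
  moreover have "\<phi> (0, ones r) = comp \<Lambda> (\<phi> (0, p)) (\<phi> (p, ones r))"
    using F_comp[OF arr(1,4)] by simp
  moreover have "src \<Lambda> (\<phi> (0, p)) = rng \<Lambda> (\<phi> (p, q))" "src \<Lambda> (\<phi> (p, q)) = rng \<Lambda> (\<phi> (q, ones r))"
    using F_ends[OF arr(1)] F_ends[OF arr(2)] F_ends[OF arr(3)] by simp_all
  moreover have "\<phi> (0, p) \<in> arr \<Lambda>" "\<phi> (p, q) \<in> arr \<Lambda>" "\<phi> (q, ones r) \<in> arr \<Lambda>"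
    using F arr by blast+
  ultimately have "splits (\<phi> (0, ones r)) (\<phi> (0, p)) (\<phi> (p, q)) (\<phi> (q, ones r))"
    unfolding splits_def by metis
  then have "segment \<Lambda> (\<phi> (0, ones r)) (h p) (h q) = \<phi> (p, q)"
  proof (rule segment_eqI)
    show "deg \<Lambda> (\<phi> (0, p)) = h p"
      using admissible_for_deg[OF h zero_le_vec p] by simp
    have hq: "h p \<le> h q" "h (q - p) = h q - h p"
      using Nvec_hom_le[OF admissible_for_hom[OF h] pq(1) Nvec_le[OF pq(2) ones_Nvec]] by auto
    then show "h p + deg \<Lambda> (\<phi> (p, q)) = h q"
      using admissible_for_deg[OF h pq] vec_add_diff[OF hq(1)] by simp
  qed
  then show ?thesis ..
qed

lemma cube_map_in_realisation:
  assumes "\<phi> \<in> cubes k \<Lambda> r" "admissible_for k \<Lambda> r \<phi> h" "t \<in> topspace (unit_box r)"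
  shows "(\<phi> (0, ones r), hom_extend r h t) \<in> topspace (box_sum k \<Lambda>)"
  using cube_top[OF assms(1,2)] hom_extend_in_box[OF admissible_for_hom[OF assms(2)] assms(3)]
  by (simp add: topspace_box_sum)

lemma continuous_map_realisation_pt:
  assumes "x \<in> arr \<Lambda>"
  shows "continuous_map (box k (deg \<Lambda> x)) (realisation k \<Lambda>) (realisation_pt k \<Lambda> x)"
proof -
  have "continuous_map (box k (deg \<Lambda> x)) (box_sum k \<Lambda>) (\<lambda>t. (x, t))"
    unfolding box_sum_def by (rule continuous_map_component_injection[OF assms])
  from continuous_map_compose[OF this quotient_imp_continuous_map[OF quotient_map_quotient_space]]
  show ?thesis
    unfolding realisation_def realisation_pt_def o_def .
qed

text \<open>
  The longest morphism of a face is the segment of $\phi(0, \mathbf{1}_{r+1})$ that starts at the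
  image of the lowest vertex of the face. Inserting \<open>l\<close> translates the coordinates by exactly that
  starting point, so \<open>realisation_pt_segment\<close> applies.
\<close>

lemma cube_map_face:
  assumes \<phi>: "\<phi> \<in> cubes k \<Lambda> (Suc r)" and i: "i \<le> r" and l: "l \<in> {0, 1}"
    and t: "t \<in> topspace (unit_box r)"
  shows "cube_map k \<Lambda> (Suc r) \<phi> (insert_coord i (real l) t) = cube_map k \<Lambda> r (face r i l \<phi>) t"
proof -
  obtain h where h: "admissible_for k \<Lambda> (Suc r) \<phi> h"
    using cubes_admissible[OF \<phi>] .
  define h' where "h' = (\<lambda>p. h (insert_coord i 0 p))"
  have h': "admissible_for k \<Lambda> r (face r i l \<phi>) h'"
    unfolding h'_def by (rule face_cube[OF \<phi> h i l])
  define a b where "a = insert_coord i l 0" and "b = insert_coord i l (ones r)"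
  have ab: "a \<le> b" "b \<le> ones (Suc r)" "b \<in> Nvec (Suc r)"
    using insert_coord_mono[OF zero_le_vec order_refl i l] insert_coord_Nvec[OF ones_Nvec i]
    by (simp_all add: a_def b_def)
  have hab: "h a \<le> h b" "h b - h a = h' (ones r)"
  proof -
    have "b - a = insert_coord i 0 (ones r)"
      by (auto simp: a_def b_def insert_coord_def fun_eq_iff)
    then show "h a \<le> h b" "h b - h a = h' (ones r)"
      using Nvec_hom_le[OF admissible_for_hom[OF h] ab(1,3)] by (simp_all add: h'_def)
  qed
  have hb: "h b \<le> deg \<Lambda> (\<phi> (0, ones (Suc r)))"
    using Nvec_hom_le[OF admissible_for_hom[OF h] ab(2) ones_Nvec] cube_top[OF \<phi> h] by simp
  have ha: "h a = (\<lambda>j. l * h (gen i) j)"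
  proof (cases "l = 0")
    case True
    then have "a = 0"
      by (auto simp: a_def insert_coord_def fun_eq_iff)
    then show ?thesis
      using True Nvec_hom_0[OF admissible_for_hom[OF h]] by (simp add: zero_fun_def)
  next
    case False
    then have "l = 1" "a = gen i"
      using l by (auto simp: a_def insert_coord_def gen_def fun_eq_iff)
    then show ?thesis
      by simp
  qed
  have "cube_map k \<Lambda> r (face r i l \<phi>) t = realisation_pt k \<Lambda> (\<phi> (a, b)) (hom_extend r h' t)"
    using cube_map_eq[OF h'] by (simp add: face_app a_def b_def)
  also have "\<phi> (a, b) = segment \<Lambda> (\<phi> (0, ones (Suc r))) (h a) (h b)"
    by (rule cube_segment[OF \<phi> h ab(1,2)])
  also have "realisation_pt k \<Lambda> \<dots> (hom_extend r h' t) =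
      realisation_pt k \<Lambda> (\<phi> (0, ones (Suc r))) (\<lambda>j. real (h a j) + hom_extend r h' t j)"
    using hom_extend_in_box[OF admissible_for_hom[OF h'] t] hab
    by (intro realisation_pt_segment[OF cube_top(1)[OF \<phi> h] hab(1) hb]) simp
  also have "\<dots> = cube_map k \<Lambda> (Suc r) \<phi> (insert_coord i (real l) t)"
    by (simp add: cube_map_eq[OF h] hom_extend_insert[OF i] ha h'_def)
  finally show ?thesis ..
qed

lemma cube_map_degeneracy:
  assumes \<phi>: "\<phi> \<in> cubes k \<Lambda> r" and i: "i \<le> r"
  shows "cube_map k \<Lambda> r \<phi> (delete_coord i t) = cube_map k \<Lambda> (Suc r) (degeneracy r i \<phi>) t"
proof -
  obtain h where h: "admissible_for k \<Lambda> r \<phi> h"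
    using cubes_admissible[OF \<phi>] .
  have "delete_coord i 0 = (0 :: nat \<Rightarrow> nat)" "delete_coord i (ones (Suc r)) = ones r"
    using i by (auto simp: delete_coord_def ones_def fun_eq_iff)
  then show ?thesis
    by (simp add: cube_map_eq[OF h] cube_map_eq[OF admissible_for_degeneracy[OF h i]] degeneracy_app
        hom_extend_delete[where h = h, OF i Nvec_hom_0[OF admissible_for_hom[OF h]]])
qed

lemma compatible_cube_map: "compatible_maps k \<Lambda> (realisation k \<Lambda>) (cube_map k \<Lambda>)"
  unfolding compatible_maps_def
proof (intro conjI allI ballI impI)
  fix r \<phi>
  assume \<phi>: "\<phi> \<in> cubes k \<Lambda> r"
  then obtain h where h: "admissible_for k \<Lambda> r \<phi> h"
    by (rule cubes_admissible)
  have "continuous_map (unit_box r) (box k (deg \<Lambda> (\<phi> (0, ones r)))) (hom_extend r h)"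
    using continuous_map_hom_extend[OF admissible_for_hom[OF h]] cube_top[OF \<phi> h] by simp
  from continuous_map_compose[OF this continuous_map_realisation_pt[OF cube_top(1)[OF \<phi> h]]]
  show "continuous_map (unit_box r) (realisation k \<Lambda>) (cube_map k \<Lambda> r \<phi>)"
    by (rule continuous_map_eq) (simp add: cube_map_eq[OF h])
qed (simp_all add: cube_map_face cube_map_degeneracy)

end


section \<open>Normal forms\<close>

lemma cube_equiv_glue:
  assumes "(x, y) \<in> cube_glue k \<Lambda>"
  shows "(x, y) \<in> cube_equiv k \<Lambda>" "(y, x) \<in> cube_equiv k \<Lambda>"
  using assms unfolding cube_equiv_def by blast+

lemma cube_equiv_trans:
  "(x, y) \<in> cube_equiv k \<Lambda> \<Longrightarrow> (y, z) \<in> cube_equiv k \<Lambda> \<Longrightarrow> (x, z) \<in> cube_equiv k \<Lambda>"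
  unfolding cube_equiv_def by (rule rtrancl_trans)

lemma delete_coord_box:
  assumes "t \<in> topspace (unit_box (Suc r))" "i \<le> r"
  shows "delete_coord i t \<in> topspace (unit_box r)"
proof -
  have t: "0 \<le> t j" "t j \<le> (if j < Suc r then 1 else 0)" "j \<ge> Suc r \<longrightarrow> t j = 0" for j
    using assms(1) by (auto simp: topspace_box ones_def split: if_splits)
  have "delete_coord i t j \<le> real (ones r j)" for j
    using t[of j] t[of "Suc j"] assms(2) by (auto simp: delete_coord_def ones_def split: if_splits)
  moreover have "delete_coord i t j = 0" if "j \<ge> r" for j
    using t(3)[of "Suc j"] assms(2) that by (auto simp: delete_coord_def)
  ultimately show ?thesis
    using t(1) by (auto simp: topspace_box delete_coord_def)
qed

lemma hom_extend_matching:
  assumes "\<forall>i<r. h (gen i) = gen (j i)" "inj_on j {..<r}"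
  shows "i < r \<Longrightarrow> hom_extend r h t (j i) = t i"
    and "a \<notin> j ` {..<r} \<Longrightarrow> hom_extend r h t a = 0"
proof -
  have *: "hom_extend r h t a = (\<Sum>i<r. if a = j i then t i else 0)" for a
    unfolding hom_extend_def using assms(1) by (intro sum.cong) (auto simp: gen_def)
  show "hom_extend r h t (j i) = t i" if "i < r"
  proof -
    have "(\<Sum>l<r. if j i = j l then t l else 0) = (\<Sum>l<r. if i = l then t l else 0)"
      using assms(2) that by (intro sum.cong) (auto simp: inj_on_def)
    then show ?thesis
      using that by (simp add: *)
  qed
  show "hom_extend r h t a = 0" if "a \<notin> j ` {..<r}"
    unfolding * using that by (intro sum.neutral) auto
qed

text \<open>
  Used to recover an admissible injection from the set of generators in its image.
\<close>

lemma strict_mono_on_image_unique: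
  fixes j j' :: "nat \<Rightarrow> nat"
  assumes j: "strict_mono_on {..<r} j" "strict_mono_on {..<r'} j'" and img: "j ` {..<r} = j' ` {..<r'}"
  shows "r = r'" "\<forall>i<r. j i = j' i"
proof -
  have "sorted (map f [0..<n]) \<and> distinct (map f [0..<n])" if "strict_mono_on {..<n} f"
    for n and f :: "nat \<Rightarrow> nat"
  proof -
    have "sorted_wrt (<) (map f [0..<n])"
      using that by (auto simp: sorted_wrt_iff_nth_less strict_mono_on_def)
    then show ?thesis
      by (simp add: strict_sorted_iff)
  qed
  from this[OF j(1)] this[OF j(2)] have eq: "map j [0..<r] = map j' [0..<r']"
    by (intro sorted_distinct_set_unique) (use img in \<open>auto simp: atLeast0LessThan\<close>)
  then have "length (map j [0..<r]) = length (map j' [0..<r'])"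
    by simp
  then show r: "r = r'"
    by simp
  show "\<forall>i<r. j i = j' i"
    using eq r by auto
qed

context higher_rank_graph
begin

text \<open>
  The condition on degrees says that the admissible map of \<open>\<phi>\<close> kills no generator, that is, that
  \<open>\<phi>\<close> is nondegenerate.
\<close>

definition generic :: "nat \<Rightarrow> (cube_arr \<Rightarrow> 'a) \<Rightarrow> (nat \<Rightarrow> real) \<Rightarrow> bool" where
  "generic r \<phi> t \<longleftrightarrow> \<phi> \<in> cubes k \<Lambda> r \<and> t \<in> topspace (unit_box r) \<and>
     (\<forall>i<r. 0 < t i \<and> t i < 1 \<and> deg \<Lambda> (\<phi> (0, gen i)) \<noteq> 0)"

text \<open>
  Both sides are segments of the longest morphism of \<open>\<phi>\<close>, by \<open>cube_segment\<close>, and the \<open>i\<close>th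
  coordinate has no influence on where these segments start and end.
\<close>

lemma degenerate_cube:
  assumes \<phi>: "\<phi> \<in> cubes k \<Lambda> (Suc r)" and i: "i \<le> r" and deg: "deg \<Lambda> (\<phi> (0, gen i)) = 0"
  shows "degeneracy r i (face r i 0 \<phi>) = \<phi>"
proof (rule extensionalityI)
  show "degeneracy r i (face r i 0 \<phi>) \<in> extensional (arr (cube_graph (Suc r)))"
    by (simp add: degeneracy_def)
  show "\<phi> \<in> extensional (arr (cube_graph (Suc r)))"
    using \<phi> by (simp add: cubes_def)
  obtain h where h: "admissible_for k \<Lambda> (Suc r) \<phi> h"
    using cubes_admissible[OF \<phi>] .
  have hom: "Nvec_hom (Suc r) k h"
    by (rule admissible_for_hom[OF h])
  have "h (gen i) = 0"
    using deg admissible_for_deg[OF h, of 0 "gen i"] gen_le_ones[of i "Suc r"] i by simp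
  have collapse: "h (insert_coord i 0 (delete_coord i p)) = h p" if p: "p \<le> ones (Suc r)" for p
  proof -
    let ?p = "insert_coord i 0 (delete_coord i p)"
    have pN: "p \<in> Nvec (Suc r)"
      by (rule Nvec_le[OF p ones_Nvec])
    have coord: "?p a = (if a = i then 0 else p a)" for a
      by (auto simp: insert_coord_def delete_coord_def)
    then have "?p \<in> Nvec (Suc r)"
      using pN by (auto simp: Nvec_def)
    then have "h ?p a = h p a" for a
      unfolding Nvec_hom_eq_sum[OF hom \<open>?p \<in> _\<close>] Nvec_hom_eq_sum[OF hom pN]
      using coord \<open>h (gen i) = 0\<close> by (intro sum.cong) auto
    then show ?thesis by auto
  qed
  fix x
  assume "x \<in> arr (cube_graph (Suc r))"
  then obtain p q where x: "x = (p, q)" "p \<le> q" "q \<le> ones (Suc r)"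
    by (metis cube_graph_arr surj_pair)
  have del: "delete_coord i p \<le> delete_coord i q" "delete_coord i q \<le> ones r"
    using delete_coord_mono[OF x(2,3) i] by auto
  have ins: "insert_coord i 0 (delete_coord i p) \<le> insert_coord i 0 (delete_coord i q)"
    "insert_coord i 0 (delete_coord i q) \<le> ones (Suc r)"
    using insert_coord_mono[OF del i, of 0] by auto
  have "degeneracy r i (face r i 0 \<phi>) x =
      \<phi> (insert_coord i 0 (delete_coord i p), insert_coord i 0 (delete_coord i q))"
    using x del by (simp add: degeneracy_app face_app)
  also have "\<dots> = \<phi> x"
    using x cube_segment[OF \<phi> h ins] cube_segment[OF \<phi> h x(2,3)] collapse order_trans[OF x(2,3)]
    by simp
  finally show "degeneracy r i (face r i 0 \<phi>) x = \<phi> x" .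
qed

text \<open>
  Each step of the induction passes to a face and drops one coordinate: at a coordinate \<open>0\<close> or \<open>1\<close> of
  \<open>t\<close> by a face identification, at a killed generator by a degeneracy identification read backwards.
\<close>

lemma normal_form:
  assumes "\<phi> \<in> cubes k \<Lambda> r" "t \<in> topspace (unit_box r)"
  shows "\<exists>r' \<phi>' t'. generic r' \<phi>' t' \<and> (((r, \<phi>), t), ((r', \<phi>'), t')) \<in> cube_equiv k \<Lambda>"
  using assms
proof (induction r arbitrary: \<phi> t)
  case 0
  then have "generic 0 \<phi> t"
    by (simp add: generic_def)
  then show ?case
    by (metis cube_equiv_def rtrancl.rtrancl_refl)
next
  case (Suc r)
  show ?case
  proof (cases "generic (Suc r) \<phi> t")
    case True
    then show ?thesis
      by (metis cube_equiv_def rtrancl.rtrancl_refl)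
  next
    case False
    have t01: "0 \<le> t i" "t i \<le> 1" for i
      using Suc.prems(2) by (auto simp: topspace_box ones_def split: if_splits)
    then obtain i where i: "i \<le> r" and alt: "t i = 0 \<or> t i = 1 \<or> deg \<Lambda> (\<phi> (0, gen i)) = 0"
      using False Suc.prems unfolding generic_def by (metis less_Suc_eq_le order_le_less)
    have t': "delete_coord i t \<in> topspace (unit_box r)"
      by (rule delete_coord_box[OF Suc.prems(2) i])
    obtain h where h: "admissible_for k \<Lambda> (Suc r) \<phi> h"
      using cubes_admissible[OF Suc.prems(1)] .
    have "\<exists>l\<in>{0, 1}. (((Suc r, \<phi>), t), ((r, face r i l \<phi>), delete_coord i t)) \<in> cube_equiv k \<Lambda>"
    proof (cases "deg \<Lambda> (\<phi> (0, gen i)) = 0")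
      case True
      have f: "face r i 0 \<phi> \<in> cubes k \<Lambda> r"
        by (rule face_cube(1)[OF Suc.prems(1) h i]) simp
      have "(((r, face r i 0 \<phi>), delete_coord i t), ((Suc r, degeneracy r i (face r i 0 \<phi>)), t))
          \<in> cube_glue k \<Lambda>"
        unfolding cube_glue_def using f i Suc.prems(2) by blast
      then show ?thesis
        unfolding degenerate_cube[OF Suc.prems(1) i True] by (blast intro: cube_equiv_glue(2))
    next
      case False
      then obtain l :: nat where l: "l \<in> {0, 1}" "t i = real l"
        using alt by (metis insertCI of_nat_0 of_nat_1)
      have "(((Suc r, \<phi>), insert_coord i (real l) (delete_coord i t)), ((r, face r i l \<phi>), delete_coord i t))
          \<in> cube_glue k \<Lambda>"
        unfolding cube_glue_def using Suc.prems(1) i l(1) t' by blast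
      then show ?thesis
        using l unfolding l(2)[symmetric] insert_delete_coord by (blast intro: cube_equiv_glue(1))
    qed
    then obtain l where l: "l \<in> {0, 1}"
      and equiv: "(((Suc r, \<phi>), t), ((r, face r i l \<phi>), delete_coord i t)) \<in> cube_equiv k \<Lambda>"
      by blast
    show ?thesis
      using Suc.IH[OF face_cube(1)[OF Suc.prems(1) h i l] t'] cube_equiv_trans[OF equiv] by blast
  qed
qed

lemma generic_matching:
  assumes g: "generic r \<phi> t" and h: "admissible_for k \<Lambda> r \<phi> h"
  obtains j where "\<forall>i<r. h (gen i) = gen (j i)" "strict_mono_on {..<r} j"
proof -
  have adm: "admissible r k h"
    using h by (simp add: admissible_for_def)
  have "h (gen i) \<noteq> 0" if "i < r" for i
    using g admissible_for_deg[OF h zero_le_vec gen_le_ones[OF that]] that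
    unfolding generic_def by (metis diff_zero)
  then have "\<forall>i<r. \<exists>j. h (gen i) = gen j"
    using adm unfolding admissible_iff by blast
  then obtain j where j: "\<forall>i<r. h (gen i) = gen (j i)"
    by metis
  moreover have "strict_mono_on {..<r} j"
    unfolding strict_mono_on_def
  proof (intro allI impI)
    fix a b
    assume A: "a \<in> {..<r} \<and> b \<in> {..<r} \<and> a < b"
    then have "h (gen a) = gen (j a)" "h (gen b) = gen (j b)" "b < r"
      using j by auto
    then show "j a < j b"
      using adm A unfolding admissible_iff by blast
  qed
  ultimately show thesis
    by (rule that)
qed

text \<open>
  The extension of the admissible map moves the coordinates of \<open>t\<close> into the positions
  \<open>j ` {..<r}\<close> and puts \<open>0\<close> elsewhere. Coordinates strictly between \<open>0\<close> and \<open>1\<close> have floor \<open>0\<close> and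
  ceiling \<open>1\<close>.
\<close>

lemma generic_floor_ceiling:
  assumes g: "generic r \<phi> t" and h: "admissible_for k \<Lambda> r \<phi> h"
    and j: "\<forall>i<r. h (gen i) = gen (j i)" "strict_mono_on {..<r} j"
  shows "vfloor (hom_extend r h t) = 0"
    and "vceiling (hom_extend r h t) = deg \<Lambda> (\<phi> (0, ones r))"
    and "{a. deg \<Lambda> (\<phi> (0, ones r)) a \<noteq> 0} = j ` {..<r}"
proof -
  have inj: "inj_on j {..<r}"
    by (rule strict_mono_on_imp_inj_on[OF j(2)])
  note E = hom_extend_matching[OF j(1) inj]
  have \<phi>: "\<phi> \<in> cubes k \<Lambda> r" and t: "i < r \<Longrightarrow> 0 < t i \<and> t i < 1" for i
    using g by (auto simp: generic_def)
  have deg: "real (deg \<Lambda> (\<phi> (0, ones r)) a) = hom_extend r h (\<lambda>i. real (ones r i)) a" for a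
    using hom_extend_of_nat[OF admissible_for_hom[OF h] ones_Nvec] cube_top[OF \<phi> h] by simp
  have deg1: "deg \<Lambda> (\<phi> (0, ones r)) (j i) = 1" if "i < r" for i
    using deg[of "j i"] E(1)[OF that] that by (simp add: ones_def)
  have deg0: "deg \<Lambda> (\<phi> (0, ones r)) a = 0" if "a \<notin> j ` {..<r}" for a
    using deg[of a] E(2)[OF that] by simp
  show "vfloor (hom_extend r h t) = 0"
  proof
    fix a
    show "vfloor (hom_extend r h t) a = 0 a"
    proof (cases "a \<in> j ` {..<r}")
      case True
      then obtain i where i: "i < r" "a = j i"
        by blast
      then have "\<lfloor>t i\<rfloor> = 0"
        using t[OF i(1)] by linarith
      then show ?thesis
        using E(1)[OF i(1)] i by (simp add: vfloor_def)
    qed (simp add: E(2) vfloor_def)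
  qed
  show "vceiling (hom_extend r h t) = deg \<Lambda> (\<phi> (0, ones r))"
  proof
    fix a
    show "vceiling (hom_extend r h t) a = deg \<Lambda> (\<phi> (0, ones r)) a"
    proof (cases "a \<in> j ` {..<r}")
      case True
      then obtain i where i: "i < r" "a = j i"
        by blast
      then have "\<lceil>t i\<rceil> = 1"
        using t[OF i(1)] by linarith
      then show ?thesis
        using E(1)[OF i(1)] i deg1 by (simp add: vceiling_def)
    qed (simp add: E(2) deg0 vceiling_def)
  qed
  show "{a. deg \<Lambda> (\<phi> (0, ones r)) a \<noteq> 0} = j ` {..<r}"
    using deg0 deg1 by force
qed

text \<open>
  By \<open>generic_floor_ceiling\<close> the segment between floor and ceiling, which the equivalence relation
  remembers, is the whole of $\phi(0, \mathbf{1}_r)$, and the fractional parts are the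
  coordinates themselves. The support of the degree then gives the admissible map, and
  \<open>cube_segment\<close> gives \<open>\<phi>\<close>.
\<close>

lemma generic_unique:
  assumes g: "generic r \<phi> t" and g': "generic r' \<phi>' t'"
    and eq: "cube_map k \<Lambda> r \<phi> t = cube_map k \<Lambda> r' \<phi>' t'"
  shows "((r, \<phi>), t) = ((r', \<phi>'), t')"
proof -
  have \<phi>: "\<phi> \<in> cubes k \<Lambda> r" "t \<in> topspace (unit_box r)"
    and \<phi>': "\<phi>' \<in> cubes k \<Lambda> r'" "t' \<in> topspace (unit_box r')"
    using g g' by (auto simp: generic_def)
  obtain h where h: "admissible_for k \<Lambda> r \<phi> h"
    using cubes_admissible[OF \<phi>(1)] .
  obtain h' where h': "admissible_for k \<Lambda> r' \<phi>' h'"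
    using cubes_admissible[OF \<phi>'(1)] .
  obtain j where j: "\<forall>i<r. h (gen i) = gen (j i)" "strict_mono_on {..<r} j"
    using generic_matching[OF g h] .
  obtain j' where j': "\<forall>i<r'. h' (gen i) = gen (j' i)" "strict_mono_on {..<r'} j'"
    using generic_matching[OF g' h'] .
  note F = generic_floor_ceiling[OF g h j] and F' = generic_floor_ceiling[OF g' h' j']
  have "realisation_pt k \<Lambda> (\<phi> (0, ones r)) (hom_extend r h t) =
      realisation_pt k \<Lambda> (\<phi>' (0, ones r')) (hom_extend r' h' t')"
    using eq by (simp only: cube_map_eq[OF h] cube_map_eq[OF h'])
  then have s: "hom_extend r h t = hom_extend r' h' t'" and top: "\<phi> (0, ones r) = \<phi>' (0, ones r')"
    unfolding realisation_pt_eq_iff[OF cube_map_in_realisation[OF \<phi>(1) h \<phi>(2)]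
        cube_map_in_realisation[OF \<phi>'(1) h' \<phi>'(2)]] F(1,2) F'(1,2)
      segment_whole[OF cube_top(1)[OF \<phi>(1) h]] segment_whole[OF cube_top(1)[OF \<phi>'(1) h']]
    by auto
  have "j ` {..<r} = j' ` {..<r'}"
    using F(3) F'(3) top by simp
  from strict_mono_on_image_unique[OF j(2) j'(2) this] have r: "r = r'" and jj: "\<forall>i<r. j i = j' i"
    by auto
  have "t i = t' i" for i
  proof (cases "i < r")
    case True
    then show ?thesis
      using hom_extend_matching(1)[OF j(1) strict_mono_on_imp_inj_on[OF j(2)], of i t]
        hom_extend_matching(1)[OF j'(1) strict_mono_on_imp_inj_on[OF j'(2)], of i t'] r jj s by simp
  next
    case False
    then show ?thesis
      using \<phi>(2) \<phi>'(2) r by (simp add: topspace_box)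
  qed
  then have tt: "t = t'"
    by auto
  have hh: "h p = h' p" if "p \<in> Nvec r" for p
  proof
    fix a
    have "p \<in> Nvec r'"
      using that r by simp
    then show "h p a = h' p a"
      unfolding Nvec_hom_eq_sum[OF admissible_for_hom[OF h] that]
        Nvec_hom_eq_sum[OF admissible_for_hom[OF h'] \<open>p \<in> Nvec r'\<close>]
      using r jj j(1) j'(1) by (intro sum.cong) auto
  qed
  have "\<phi> = \<phi>'"
  proof (rule extensionalityI)
    show "\<phi> \<in> extensional (arr (cube_graph r))" "\<phi>' \<in> extensional (arr (cube_graph r))"
      using \<phi>(1) \<phi>'(1) r by (auto simp: cubes_def)
    fix x
    assume "x \<in> arr (cube_graph r)"
    then obtain p q where x: "x = (p, q)" "p \<le> q" "q \<le> ones r"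
      by (metis cube_graph_arr surj_pair)
    have "q \<in> Nvec r" "p \<in> Nvec r"
      using Nvec_le[OF x(3) ones_Nvec] Nvec_le[OF x(2)] by auto
    then show "\<phi> x = \<phi>' x"
      using cube_segment[OF \<phi>(1) h x(2,3)] cube_segment[OF \<phi>'(1) h' x(2)] x r hh top by simp
  qed
  then show ?thesis
    using r tt by simp
qed

lemma compatible_eq_if_cube_map_eq:
  assumes f: "compatible_maps k \<Lambda> X f"
    and \<phi>: "\<phi> \<in> cubes k \<Lambda> r" "t \<in> topspace (unit_box r)"
    and \<phi>': "\<phi>' \<in> cubes k \<Lambda> r'" "t' \<in> topspace (unit_box r')"
    and eq: "cube_map k \<Lambda> r \<phi> t = cube_map k \<Lambda> r' \<phi>' t'"
  shows "f r \<phi> t = f r' \<phi>' t'"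
proof -
  obtain r0 \<phi>0 t0 where 0: "generic r0 \<phi>0 t0" "(((r, \<phi>), t), ((r0, \<phi>0), t0)) \<in> cube_equiv k \<Lambda>"
    using normal_form[OF \<phi>] by blast
  obtain r1 \<phi>1 t1 where 1: "generic r1 \<phi>1 t1" "(((r', \<phi>'), t'), ((r1, \<phi>1), t1)) \<in> cube_equiv k \<Lambda>"
    using normal_form[OF \<phi>'] by blast
  have "cube_map k \<Lambda> r0 \<phi>0 t0 = cube_map k \<Lambda> r1 \<phi>1 t1"
    using eq cube_equiv_imp_eq[OF compatible_cube_map 0(2)] cube_equiv_imp_eq[OF compatible_cube_map 1(2)]
    by simp
  then show ?thesis
    using generic_unique[OF 0(1) 1(1)] cube_equiv_imp_eq[OF f 0(2)] cube_equiv_imp_eq[OF f 1(2)] by simp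
qed

end


section \<open>Parametrising unit cells by cubes\<close>

context higher_rank_graph
begin

text \<open>
  A morphism \<open>\<beta>\<close> of degree at most $\mathbf{1}_k$ is the longest morphism of the cube
  $(p, q) \mapsto \beta(h(p), h(q))$, where \<open>h\<close> enumerates the support of the degree of \<open>\<beta>\<close> in
  increasing order. The inverse \<open>T\<close> of the extension of \<open>h\<close> just selects the coordinates in that
  support.
\<close>

lemma parametrising_cube:
  assumes \<beta>: "\<beta> \<in> arr \<Lambda>" and le: "deg \<Lambda> \<beta> \<le> ones k"
  obtains r \<phi> T where "\<phi> \<in> cubes k \<Lambda> r" "continuous_map (box k (deg \<Lambda> \<beta>)) (unit_box r) T"
    "\<forall>s\<in>topspace (box k (deg \<Lambda> \<beta>)). cube_map k \<Lambda> r \<phi> (T s) = realisation_pt k \<Lambda> \<beta> s"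
proof -
  define S where "S = {a. deg \<Lambda> \<beta> a \<noteq> 0}"
  have le': "deg \<Lambda> \<beta> a \<le> (if a < k then 1 else 0)" for a
    using le by (simp add: le_fun_def ones_def)
  have S: "S \<subseteq> {..<k}"
  proof
    fix a
    assume "a \<in> S"
    then show "a \<in> {..<k}"
      using le'[of a] by (auto simp: S_def split: if_splits)
  qed
  have deg_S: "deg \<Lambda> \<beta> a = 1" if "a \<in> S" for a
    using that le'[of a] by (auto simp: S_def split: if_splits)
  define L where "L = sorted_list_of_set S"
  have "finite S"
    using S finite_subset by blast
  then have L: "set L = S" "sorted_wrt (<) L"
    by (simp_all add: L_def)
  define r where "r = length L"
  define j where "j = (\<lambda>i. L ! i)"
  have j: "strict_mono_on {..<r} j" "j ` {..<r} = S"
    using sorted_wrt_nth_less[OF L(2)] L(1)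
    by (auto simp: strict_mono_on_def j_def r_def set_conv_nth)
  define h where "h = (\<lambda>p a. \<Sum>i<r. p i * gen (j i) a)"
  have h_gen: "h (gen i) = gen (j i)" if "i < r" for i
  proof
    fix a
    have "h (gen i) a = (\<Sum>l<r. if l = i then gen (j l) a else 0)"
      unfolding h_def by (intro sum.cong) (auto simp: gen_def)
    then show "h (gen i) a = gen (j i) a"
      using that by simp
  qed
  have jk: "j i < k" if "i < r" for i
    using j(2) S that by auto
  have hom: "Nvec_hom r k h"
    unfolding Nvec_hom_def
  proof (intro conjI ballI)
    show "h \<in> Nvec r \<rightarrow> Nvec k"
      using jk by (fastforce simp: h_def Nvec_def gen_def intro!: sum.neutral)
  qed (auto simp: h_def fun_eq_iff algebra_simps sum.distrib)
  have adm: "admissible r k h"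
    unfolding admissible_iff
  proof (intro conjI allI impI)
    fix a a' b b'
    assume "a < a' \<and> a' < r \<and> h (gen a) = gen b \<and> h (gen a') = gen b'"
    then have "b = j a" "b' = j a'" "a \<in> {..<r}" "a' \<in> {..<r}" "a < a'"
      using h_gen[of a] h_gen[of a'] by auto
    then show "b < b'"
      using j(1) by (auto simp: strict_mono_on_def)
  qed (use hom h_gen jk in auto)
  note E = hom_extend_matching[of r h j, OF _ strict_mono_on_imp_inj_on[OF j(1)]]
  have h_ones: "h (ones r) = deg \<Lambda> \<beta>"
  proof
    fix a
    have "real (h (ones r) a) = hom_extend r h (\<lambda>i. real (ones r i)) a"
      using hom_extend_of_nat[OF hom ones_Nvec] by simp
    also have "\<dots> = real (deg \<Lambda> \<beta> a)"
    proof (cases "a \<in> S")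
      case True
      then obtain i where "i < r" "a = j i"
        using j(2) by blast
      then show ?thesis
        using E(1)[of i "\<lambda>i. real (ones r i)"] h_gen deg_S[OF True] by (simp add: ones_def)
    next
      case False
      then show ?thesis
        using E(2)[of a] h_gen j(2) by (simp add: S_def)
    qed
    finally show "h (ones r) a = deg \<Lambda> \<beta> a"
      by simp
  qed
  have hle: "h p \<le> h q \<and> h q \<le> deg \<Lambda> \<beta> \<and> h (q - p) = h q - h p" if "p \<le> q" "q \<le> ones r" for p q
    using Nvec_hom_le[OF hom that(1) Nvec_le[OF that(2) ones_Nvec]]
      Nvec_hom_le[OF hom that(2) ones_Nvec] h_ones by simp
  define \<phi> where "\<phi> = restrict (\<lambda>(p, q). segment \<Lambda> \<beta> (h p) (h q)) (arr (cube_graph r))"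
  have \<phi>: "\<phi> (p, q) = segment \<Lambda> \<beta> (h p) (h q)" if "p \<le> q" "q \<le> ones r" for p q
    using that by (simp add: \<phi>_def cube_graph_arr)
  have is_functor: "cat_functor (cube_graph r) \<Lambda> \<phi>"
    unfolding cat_functor_def
  proof (intro conjI ballI impI)
    show "\<phi> \<in> arr (cube_graph r) \<rightarrow> arr \<Lambda>"
      using \<phi> hle arr_segment[OF \<beta>] by (auto simp: cube_graph_arr)
  next
    fix x
    assume "x \<in> arr (cube_graph r)"
    then obtain p q where x: "x = (p, q)" "p \<le> q" "q \<le> ones r"
      by (metis cube_graph_arr surj_pair)
    then have "p \<le> ones r"
      by simp
    then show "\<phi> (rng (cube_graph r) x) = rng \<Lambda> (\<phi> x)" "\<phi> (src (cube_graph r) x) = src \<Lambda> (\<phi> x)"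
      using x segment_ends[OF \<beta>, of "h p" "h q"] hle[OF x(2,3)] by (simp_all add: \<phi>)
  next
    fix x y
    assume "x \<in> arr (cube_graph r)" "y \<in> arr (cube_graph r)" "src (cube_graph r) x = rng (cube_graph r) y"
    then obtain p q u where x: "x = (p, q)" "y = (q, u)" "p \<le> q" "q \<le> u" "u \<le> ones r"
      by (cases x; cases y) (auto simp: cube_graph_arr)
    then have "p \<le> u" "q \<le> ones r"
      by simp_all
    then show "\<phi> (comp (cube_graph r) x y) = comp \<Lambda> (\<phi> x) (\<phi> y)"
      using x segment_comp(2)[OF \<beta>, of "h p" "h q" "h u"] hle[of p q] hle[of q u] by (simp add: \<phi>)
  qed
  have af: "admissible_for k \<Lambda> r \<phi> h"
    unfolding admissible_for_def
    using adm \<phi> hle deg_segment[OF \<beta>] by (auto simp: cube_graph_arr)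
  have cube: "\<phi> \<in> cubes k \<Lambda> r"
    by (rule cubesI[OF _ is_functor af]) (simp add: \<phi>_def)
  have top: "\<phi> (0, ones r) = \<beta>"
    using \<phi>[of 0 "ones r"] Nvec_hom_0[OF hom] h_ones segment_whole[OF \<beta>] by simp
  define T where "T = (\<lambda>s i. if i < r then s (j i) else 0 :: real)"
  have T: "continuous_map (box k (deg \<Lambda> \<beta>)) (unit_box r) T"
  proof (rule continuous_map_into_box)
    show "continuous_map (box k (deg \<Lambda> \<beta>)) euclideanreal (\<lambda>s. T s i)" for i
      by (cases "i < r") (simp_all add: T_def continuous_map_box_coord)
    have "s (j i) \<le> 1" if "s \<in> topspace (box k (deg \<Lambda> \<beta>))" "i < r" for s i
      using that(1) deg_S[of "j i"] j(2) that(2) unfolding topspace_box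
      by (metis (mono_tags, lifting) imageI lessThan_iff mem_Collect_eq of_nat_1)
    then show "T ` topspace (box k (deg \<Lambda> \<beta>)) \<subseteq> topspace (unit_box r)"
      by (auto simp: topspace_box T_def ones_def)
  qed
  have "hom_extend r h (T s) = s" if s: "s \<in> topspace (box k (deg \<Lambda> \<beta>))" for s
  proof
    fix a
    show "hom_extend r h (T s) a = s a"
    proof (cases "a \<in> S")
      case True
      then obtain i where "i < r" "a = j i"
        using j(2) by blast
      then show ?thesis
        using E(1)[of i "T s"] h_gen by (simp add: T_def)
    next
      case False
      then have "s a \<le> real 0" "0 \<le> s a"
        using s unfolding topspace_box S_def by (metis (mono_tags, lifting) mem_Collect_eq)+
      then show ?thesis
        using E(2)[of a] h_gen j(2) False by simp
    qed
  qed
  then have "cube_map k \<Lambda> r \<phi> (T s) = realisation_pt k \<Lambda> \<beta> s"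
    if "s \<in> topspace (box k (deg \<Lambda> \<beta>))" for s
    using that by (simp add: cube_map_eq[OF af] top)
  then show thesis
    using that cube T by blast
qed

definition unit_cell :: "(nat \<Rightarrow> nat) \<Rightarrow> (nat \<Rightarrow> real) set" where
  "unit_cell n = {t. \<forall>i. real (n i) \<le> t i \<and> t i \<le> real (n i) + 1}"

lemma unit_cell_parametrised:
  assumes x: "x \<in> arr \<Lambda>" and n: "n \<le> deg \<Lambda> x"
  obtains r \<phi> T where "\<phi> \<in> cubes k \<Lambda> r"
    "continuous_map (subtopology (box k (deg \<Lambda> x)) (unit_cell n)) (unit_box r) T"
    "\<forall>t\<in>topspace (box k (deg \<Lambda> x)) \<inter> unit_cell n. cube_map k \<Lambda> r \<phi> (T t) = realisation_pt k \<Lambda> x t"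
proof -
  let ?C = "subtopology (box k (deg \<Lambda> x)) (unit_cell n)"
  \<comment> \<open>the upper corner of the cell, cut off where the box ends\<close>
  define m where "m = (\<lambda>i. min (n i + 1) (deg \<Lambda> x i))"
  have m: "n \<le> m" "m \<le> deg \<Lambda> x"
    using n by (auto simp: m_def le_fun_def)
  note \<beta> = arr_segment[OF x m] deg_segment[OF x m]
  have N: "deg \<Lambda> x i = 0" "n i = 0" if "i \<ge> k" for i
    using deg_Nvec[OF x] Nvec_le[OF n deg_Nvec[OF x]] that by (auto simp: Nvec_def)
  have le: "deg \<Lambda> (segment \<Lambda> x n m) \<le> ones k"
    unfolding \<beta>(2) using N by (auto simp: le_fun_def m_def ones_def)
  obtain r \<phi> T where T: "\<phi> \<in> cubes k \<Lambda> r"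
    "continuous_map (box k (m - n)) (unit_box r) T"
    "\<forall>s\<in>topspace (box k (m - n)). cube_map k \<Lambda> r \<phi> (T s) = realisation_pt k \<Lambda> (segment \<Lambda> x n m) s"
    by (rule parametrising_cube[OF \<beta>(1) le, unfolded \<beta>(2)])
  define D where "D = (\<lambda>t i. t i - real (n i))"
  have D: "D t \<in> topspace (box k (m - n))" if "t \<in> topspace (box k (deg \<Lambda> x))" "t \<in> unit_cell n" for t
  proof -
    have t: "real (n i) \<le> t i" "t i \<le> real (n i) + 1" "t i \<le> real (deg \<Lambda> x i)" "i \<ge> k \<longrightarrow> t i = 0" for i
      using that by (auto simp: topspace_box unit_cell_def)
    have "D t i \<le> real ((m - n) i)" for i
    proof -
      have "t i \<le> real (m i)"
        using t(2,3)[of i] by (auto simp: m_def min_def)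
      moreover have "n i \<le> m i"
        using m(1) by (simp add: le_fun_def)
      ultimately show ?thesis
        by (simp add: D_def of_nat_diff)
    qed
    then show ?thesis
      using t N by (auto simp: topspace_box D_def)
  qed
  have "continuous_map ?C (box k (m - n)) D"
  proof (rule continuous_map_into_box)
    show "continuous_map ?C euclideanreal (\<lambda>t. D t i)" for i
      unfolding D_def
      by (intro continuous_map_diff continuous_map_from_subtopology continuous_map_box_coord) simp
  qed (use D in auto)
  from continuous_map_compose[OF this T(2)] have "continuous_map ?C (unit_box r) (\<lambda>t. T (D t))"
    by (simp add: o_def)
  moreover have "cube_map k \<Lambda> r \<phi> (T (D t)) = realisation_pt k \<Lambda> x t"
    if "t \<in> topspace (box k (deg \<Lambda> x))" "t \<in> unit_cell n" for t
    using T(3)[rule_format, OF D[OF that]] realisation_pt_segment[OF x m D[OF that]] by (simp add: D_def)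
  ultimately show thesis
    using that T(1) by blast
qed

lemma unit_cells_cover:
  assumes "t \<in> topspace (box k (deg \<Lambda> x))"
  shows "vfloor t \<le> deg \<Lambda> x" "t \<in> unit_cell (vfloor t)"
proof -
  have "0 \<le> t i" "t i \<le> real (deg \<Lambda> x i)" for i
    using assms by (auto simp: topspace_box)
  then have t: "0 \<le> \<lfloor>t i\<rfloor>" "\<lfloor>t i\<rfloor> \<le> int (deg \<Lambda> x i)" for i
    by (simp, metis floor_mono floor_of_nat)
  then have "real (nat \<lfloor>t i\<rfloor>) = of_int \<lfloor>t i\<rfloor>" for i
    by simp
  then have "real (nat \<lfloor>t i\<rfloor>) \<le> t i" "t i \<le> real (nat \<lfloor>t i\<rfloor>) + 1" "nat \<lfloor>t i\<rfloor> \<le> deg \<Lambda> x i" for i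
    using t(2)[of i] by (simp_all add: nat_le_iff)
  then show "vfloor t \<le> deg \<Lambda> x" "t \<in> unit_cell (vfloor t)"
    by (simp_all add: vfloor_def unit_cell_def le_fun_def)
qed

lemma cube_maps_cover:
  assumes "z \<in> topspace (realisation k \<Lambda>)"
  obtains r \<phi> t where "\<phi> \<in> cubes k \<Lambda> r" "t \<in> topspace (unit_box r)" "z = cube_map k \<Lambda> r \<phi> t"
proof -
  obtain x t where x: "x \<in> arr \<Lambda>" "t \<in> topspace (box k (deg \<Lambda> x))" "z = realisation_pt k \<Lambda> x t"
    using assms by (auto simp: realisation_def quotient_def topspace_box_sum realisation_pt_def)
  note c = unit_cells_cover[OF x(2)]
  obtain r \<phi> T where T: "\<phi> \<in> cubes k \<Lambda> r"
    "continuous_map (subtopology (box k (deg \<Lambda> x)) (unit_cell (vfloor t))) (unit_box r) T"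
    "cube_map k \<Lambda> r \<phi> (T t) = realisation_pt k \<Lambda> x t"
    using unit_cell_parametrised[OF x(1) c(1)] x(2) c(2) by (metis IntI)
  have "T t \<in> topspace (unit_box r)"
    using T(2) x(2) c(2) by (auto simp: continuous_map_def)
  then show thesis
    using that T x(3) by metis
qed

lemma finite_Nvec_le: "finite {n. n \<le> d}" if "d \<in> Nvec k" for d :: "nat \<Rightarrow> nat"
proof (rule finite_subset)
  show "{n. n \<le> d} \<subseteq> {f. \<forall>i. (i \<in> {..<k} \<longrightarrow> f i \<in> {..Max (d ` {..<k})}) \<and> (i \<notin> {..<k} \<longrightarrow> f i = 0)}"
  proof (intro subsetI CollectI allI conjI impI)
    fix n i
    assume n: "n \<in> {n. n \<le> d}"
    then have "n i \<le> d i"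
      by (simp add: le_fun_def)
    then show "n i \<in> {..Max (d ` {..<k})}" if "i \<in> {..<k}"
      using that by (simp add: order_trans[OF _ Max_ge])
    show "n i = 0" if "i \<notin> {..<k}"
      using \<open>n i \<le> d i\<close> that \<open>d \<in> Nvec k\<close> by (simp add: Nvec_def)
  qed
  show "finite {f. \<forall>i. (i \<in> {..<k} \<longrightarrow> f i \<in> {..Max (d ` {..<k})}) \<and> (i \<notin> {..<k} \<longrightarrow> f i = (0::nat))}"
    by (rule finite_set_of_finite_funs) simp_all
qed

lemma closedin_unit_cell: "closedin (box k d) (topspace (box k d) \<inter> unit_cell n)"
proof -
  have "closedin (box k d) {t \<in> topspace (box k d). t i \<in> {real (n i)..real (n i) + 1}}" for i
    by (rule closedin_continuous_map_preimage[OF continuous_map_box_coord]) simp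
  then have "closedin (box k d) (\<Inter>i. {t \<in> topspace (box k d). t i \<in> {real (n i)..real (n i) + 1}})"
    by (intro closedin_Inter) auto
  moreover have "(\<Inter>i. {t \<in> topspace (box k d). t i \<in> {real (n i)..real (n i) + 1}}) =
      topspace (box k d) \<inter> unit_cell n"
    by (auto simp: unit_cell_def)
  ultimately show ?thesis
    by simp
qed

text \<open>
  The realisation carries the quotient topology of a disjoint union of boxes, so continuity is tested
  on each box.
\<close>

lemma continuous_map_from_realisation:
  assumes g: "\<And>x. x \<in> arr \<Lambda> \<Longrightarrow> continuous_map (box k (deg \<Lambda> x)) X (\<lambda>t. g (realisation_pt k \<Lambda> x t))"
  shows "continuous_map (realisation k \<Lambda>) X g"
proof -
  have "continuous_map (box_sum k \<Lambda>) X (g \<circ> (\<lambda>y. realisation_rel k \<Lambda> `` {y}))"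
    unfolding continuous_map_def
  proof (intro conjI allI impI)
    show "g \<circ> (\<lambda>y. realisation_rel k \<Lambda> `` {y}) \<in> topspace (box_sum k \<Lambda>) \<rightarrow> topspace X"
      using g by (fastforce simp: topspace_box_sum continuous_map_def realisation_pt_def)
    fix U
    assume U: "openin X U"
    show "openin (box_sum k \<Lambda>)
        {y \<in> topspace (box_sum k \<Lambda>). (g \<circ> (\<lambda>y. realisation_rel k \<Lambda> `` {y})) y \<in> U}" (is "openin _ ?V")
    proof -
      have "?V \<subseteq> Sigma (arr \<Lambda>) (topspace \<circ> (\<lambda>x. box k (deg \<Lambda> x)))"
        by (auto simp: topspace_box_sum)
      moreover have "openin (box k (deg \<Lambda> x)) {t. (x, t) \<in> ?V}" if "x \<in> arr \<Lambda>" for x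
      proof -
        have "{t. (x, t) \<in> ?V} = {t \<in> topspace (box k (deg \<Lambda> x)). g (realisation_pt k \<Lambda> x t) \<in> U}"
          using that by (auto simp: topspace_box_sum realisation_pt_def)
        then show ?thesis
          using openin_continuous_map_preimage[OF g[OF that] U] by simp
      qed
      ultimately show ?thesis
        unfolding box_sum_def openin_sum_topology by blast
    qed
  qed
  then show ?thesis
    unfolding realisation_def by (rule continuous_compose_quotient_map[OF quotient_map_quotient_space])
qed


section \<open>The universal property of the realisation\<close>

text \<open>
  The space \<open>X\<close> may have points of any type, so this provides maps out of the realisation both to
  itself and to a cubical realisation on another type.
\<close>

theorem realisation_is_cubical_realisation:
  "cubical_realisation TYPE('x) k \<Lambda> (realisation k \<Lambda>) (cube_map k \<Lambda>)"
  unfolding cubical_realisation_def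
proof (intro conjI allI impI)
  fix X :: "'x topology" and f
  assume f: "compatible_maps k \<Lambda> X f"
  \<comment> \<open>The value does not depend on the choice, since cubes hitting the same point have equal \<open>f\<close>.\<close>
  define g where "g z = (SOME y. \<exists>r \<phi> t. \<phi> \<in> cubes k \<Lambda> r \<and> t \<in> topspace (unit_box r) \<and>
      z = cube_map k \<Lambda> r \<phi> t \<and> y = f r \<phi> t)" for z
  have g: "g (cube_map k \<Lambda> r \<phi> t) = f r \<phi> t" if "\<phi> \<in> cubes k \<Lambda> r" "t \<in> topspace (unit_box r)" for r \<phi> t
    unfolding g_def
  proof (rule some_equality)
    show "\<exists>r' \<phi>' t'. \<phi>' \<in> cubes k \<Lambda> r' \<and> t' \<in> topspace (unit_box r') \<and>
        cube_map k \<Lambda> r \<phi> t = cube_map k \<Lambda> r' \<phi>' t' \<and> f r \<phi> t = f r' \<phi>' t'"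
      using that by blast
    show "y = f r \<phi> t" if y: "\<exists>r' \<phi>' t'. \<phi>' \<in> cubes k \<Lambda> r' \<and> t' \<in> topspace (unit_box r') \<and>
        cube_map k \<Lambda> r \<phi> t = cube_map k \<Lambda> r' \<phi>' t' \<and> y = f r' \<phi>' t'" for y
      using y compatible_eq_if_cube_map_eq[OF f \<open>\<phi> \<in> _\<close> \<open>t \<in> _\<close>] by metis
  qed
  have fcont: "continuous_map (unit_box r) X (f r \<phi>)" if "\<phi> \<in> cubes k \<Lambda> r" for r \<phi>
    using f that by (simp add: compatible_maps_def)
  have "continuous_map (realisation k \<Lambda>) X g"
  proof (rule continuous_map_from_realisation)
    fix x
    assume x: "x \<in> arr \<Lambda>"
    let ?B = "box k (deg \<Lambda> x)"
    show "continuous_map ?B X (\<lambda>t. g (realisation_pt k \<Lambda> x t))"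
    proof (rule pasting_lemma_closed[where I = "{n. n \<le> deg \<Lambda> x}"
          and T = "\<lambda>n. topspace ?B \<inter> unit_cell n" and f = "\<lambda>n t. g (realisation_pt k \<Lambda> x t)"])
      show "finite {n. n \<le> deg \<Lambda> x}"
        by (rule finite_Nvec_le[OF deg_Nvec[OF x]])
      show "closedin ?B (topspace ?B \<inter> unit_cell n)" for n
        by (rule closedin_unit_cell)
      fix n
      assume "n \<in> {n. n \<le> deg \<Lambda> x}"
      then have n: "n \<le> deg \<Lambda> x"
        by simp
      obtain r \<phi> T where T: "\<phi> \<in> cubes k \<Lambda> r"
        "continuous_map (subtopology ?B (unit_cell n)) (unit_box r) T"
        "\<forall>t\<in>topspace ?B \<inter> unit_cell n. cube_map k \<Lambda> r \<phi> (T t) = realisation_pt k \<Lambda> x t"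
        by (rule unit_cell_parametrised[OF x n])
      have "continuous_map (subtopology ?B (unit_cell n)) X (\<lambda>t. g (realisation_pt k \<Lambda> x t))"
      proof (rule continuous_map_eq[OF continuous_map_compose[OF T(2) fcont[OF T(1)]]])
        fix t
        assume t: "t \<in> topspace (subtopology ?B (unit_cell n))"
        then have "T t \<in> topspace (unit_box r)"
          using T(2) by (auto simp: continuous_map_def)
        then show "(f r \<phi> \<circ> T) t = g (realisation_pt k \<Lambda> x t)"
          using g[OF T(1)] T(3) t by fastforce
      qed
      then show "continuous_map (subtopology ?B (topspace ?B \<inter> unit_cell n)) X
          (\<lambda>t. g (realisation_pt k \<Lambda> x t))"
        by (simp add: subtopology_restrict)
    next
      fix t
      assume "t \<in> topspace ?B"
      then show "\<exists>n. n \<in> {n. n \<le> deg \<Lambda> x} \<and> t \<in> topspace ?B \<inter> unit_cell n \<and>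
          g (realisation_pt k \<Lambda> x t) = g (realisation_pt k \<Lambda> x t)"
        using unit_cells_cover[of t x] by (intro exI[of _ "vfloor t"]) simp
    qed simp
  qed
  show "\<exists>!\<pi>. induced_map k \<Lambda> (realisation k \<Lambda>) (cube_map k \<Lambda>) X f \<pi>"
  proof (rule ex1I[of _ "restrict g (topspace (realisation k \<Lambda>))"])
    show "induced_map k \<Lambda> (realisation k \<Lambda>) (cube_map k \<Lambda>) X f (restrict g (topspace (realisation k \<Lambda>)))"
      unfolding induced_map_def
    proof (intro conjI allI ballI)
      show "continuous_map (realisation k \<Lambda>) X (restrict g (topspace (realisation k \<Lambda>)))"
        using \<open>continuous_map (realisation k \<Lambda>) X g\<close> by (rule continuous_map_eq) simp
      fix r \<phi> t
      assume A: "\<phi> \<in> cubes k \<Lambda> r" "t \<in> topspace (unit_box r)"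
      then have "continuous_map (unit_box r) (realisation k \<Lambda>) (cube_map k \<Lambda> r \<phi>)"
        using compatible_cube_map by (simp add: compatible_maps_def)
      then have "cube_map k \<Lambda> r \<phi> t \<in> topspace (realisation k \<Lambda>)"
        using A(2) by (blast dest: continuous_map_funspace)
      then show "restrict g (topspace (realisation k \<Lambda>)) (cube_map k \<Lambda> r \<phi> t) = f r \<phi> t"
        using g[OF A] by simp
    qed simp
  next
    fix \<pi>
    assume \<pi>: "induced_map k \<Lambda> (realisation k \<Lambda>) (cube_map k \<Lambda>) X f \<pi>"
    show "\<pi> = restrict g (topspace (realisation k \<Lambda>))"
    proof (rule extensionalityI)
      show "\<pi> \<in> extensional (topspace (realisation k \<Lambda>))"
        using \<pi> by (simp add: induced_map_def)
      fix z
      assume z: "z \<in> topspace (realisation k \<Lambda>)"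
      then obtain r \<phi> t where "\<phi> \<in> cubes k \<Lambda> r" "t \<in> topspace (unit_box r)" "z = cube_map k \<Lambda> r \<phi> t"
        by (rule cube_maps_cover)
      then show "\<pi> z = restrict g (topspace (realisation k \<Lambda>)) z"
        using z g \<pi> by (simp add: induced_map_def)
    qed simp
  qed
qed (rule compatible_cube_map)

end

text \<open>
  The composite and the identity are both induced by the family \<open>hat\<close> itself, so uniqueness makes
  them agree.
\<close>

lemma induced_map_inverse:
  fixes R :: "'r topology" and S :: "'x topology"
  assumes R: "cubical_realisation TYPE('r) k \<Lambda> R hat"
    and \<pi>: "induced_map k \<Lambda> R hat S hat' \<pi>" and \<sigma>: "induced_map k \<Lambda> S hat' R hat \<sigma>"
    and z: "z \<in> topspace R"
  shows "\<sigma> (\<pi> z) = z"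
proof -
  have hat: "compatible_maps k \<Lambda> R hat"
    using R by (simp add: cubical_realisation_def)
  then have mem: "hat r \<phi> t \<in> topspace R" if "\<phi> \<in> cubes k \<Lambda> r" "t \<in> topspace (unit_box r)" for r \<phi> t
    using that unfolding compatible_maps_def continuous_map_def by blast
  have "induced_map k \<Lambda> R hat R hat (restrict (\<sigma> \<circ> \<pi>) (topspace R))"
    unfolding induced_map_def
  proof (intro conjI allI ballI)
    have "continuous_map R R (\<sigma> \<circ> \<pi>)"
      using \<pi> \<sigma> continuous_map_compose unfolding induced_map_def by blast
    then show "continuous_map R R (restrict (\<sigma> \<circ> \<pi>) (topspace R))"
      by (rule continuous_map_eq) simp
  qed (use \<pi> \<sigma> mem in \<open>simp_all add: induced_map_def\<close>)
  moreover have "induced_map k \<Lambda> R hat R hat (restrict id (topspace R))"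
    unfolding induced_map_def
  proof (intro conjI allI ballI)
    show "continuous_map R R (restrict id (topspace R))"
      by (rule continuous_map_eq[OF continuous_map_id]) simp
  qed (use mem in simp_all)
  ultimately have "restrict (\<sigma> \<circ> \<pi>) (topspace R) = restrict id (topspace R)"
    using R hat unfolding cubical_realisation_def by blast
  then have "restrict (\<sigma> \<circ> \<pi>) (topspace R) z = restrict id (topspace R) z"
    by simp
  then show ?thesis
    using z by simp
qed

lemma cubical_realisation_unique:
  fixes R :: "'r topology" and S :: "'x topology"
  assumes R: "cubical_realisation TYPE('r) k \<Lambda> R hat"
    and S: "cubical_realisation TYPE('x) k \<Lambda> S hat'" "cubical_realisation TYPE('r) k \<Lambda> S hat'"
    and \<pi>: "induced_map k \<Lambda> R hat S hat' \<pi>"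
  shows "homeomorphic_map R S \<pi>"
proof -
  obtain \<sigma> where \<sigma>: "induced_map k \<Lambda> S hat' R hat \<sigma>"
    using R S(2) unfolding cubical_realisation_def by blast
  have "homeomorphic_maps R S \<pi> \<sigma>"
    unfolding homeomorphic_maps_def
    using \<pi> \<sigma> induced_map_inverse[OF R \<pi> \<sigma>] induced_map_inverse[OF S(1) \<sigma> \<pi>]
    by (simp add: induced_map_def)
  then show ?thesis
    by (rule homeomorphic_maps_imp_map)
qed

theorem theoremB2:
  fixes k :: nat and \<Lambda> :: "'a graded_cat"
    and R :: "'r topology" and hat :: "nat \<Rightarrow> (cube_arr \<Rightarrow> 'a) \<Rightarrow> (nat \<Rightarrow> real) \<Rightarrow> 'r"
  assumes "k_graph k \<Lambda>"
    and "cubical_realisation TYPE('r) k \<Lambda> R hat"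
    and "cubical_realisation TYPE(('a \<times> (nat \<Rightarrow> real)) set) k \<Lambda> R hat"
  shows "(\<exists>!\<pi>. induced_map k \<Lambda> R hat (realisation k \<Lambda>) (cube_map k \<Lambda>) \<pi>) \<and>
         (\<forall>\<pi>. induced_map k \<Lambda> R hat (realisation k \<Lambda>) (cube_map k \<Lambda>) \<pi> \<longrightarrow>
              homeomorphic_map R (realisation k \<Lambda>) \<pi>)"
proof -
  interpret higher_rank_graph k \<Lambda>
    by (rule higher_rank_graph.intro) fact
  show ?thesis
  proof (intro conjI allI impI)
    show "\<exists>!\<pi>. induced_map k \<Lambda> R hat (realisation k \<Lambda>) (cube_map k \<Lambda>) \<pi>"
      using assms(3) compatible_cube_map unfolding cubical_realisation_def by blast
  next
    fix \<pi>
    assume "induced_map k \<Lambda> R hat (realisation k \<Lambda>) (cube_map k \<Lambda>) \<pi>"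
    then show "homeomorphic_map R (realisation k \<Lambda>) \<pi>"
      using cubical_realisation_unique[OF assms(2) realisation_is_cubical_realisation
          realisation_is_cubical_realisation] by blast
  qed
qed

end
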